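(* Let $n\ge4$ and let $T$ be a 2-tree on $[n-1]$. The $(3n-9)\times(2n-6)$ integer matrix $H_T$ constructed inductively in the context is the Horn matrix of the very affine variety $X_T\subset(\mathbb{C}^* )^{2n-6}$. Moreover, there exists a sign vector $\lambda\in\{-1,+1\}^{2n-6}$ such that, for general complex $s=(s_{ij})_{ij\in T}$, $$\hat p=\lambda\star(H_T\,s)^{H_T}$$ is the unique critical point, expressed in the coordinates $(p_{ij})_{ij\in T}$ of $X_T$, of the scattering potential $L_T=\sum_{ij\in T}s_{ij}\log(p_{ij})$.
   Context: Coordinates. Put $y_1=0$, $y_2=1$, $y_j=x_{j-2}$ for $3\le j\le n-1$, where $x_1,\dots,x_{n-3}$ are complex coordinates, and $p_{ij}=y_j-y_i$ for $1\le i<j\le n-1$. So $p_{12}=1$. 2-trees. A 2-tree $T$ on $[n-1]=\{1,\dots,n-1\}$ is a graph constructed as follows: start with the single edge $12$; for $k=3,4,\dots,n-1$ successively, select an edge $ij$ of the current graph (with $i,j\in\{1,\dots,k-1\}$) and add the new edges $ik$ and $jk$. Such a graph has $2n-5$ edges. It is identified with the set of its $m=2n-6$ edges different from $12$, again denoted $T$. The variety $X_T$ and critical points. $X_T\subset(\mathbb{C}^* )^{m}$ is the $(n-3)$-dimensional very affine variety consisting of all points $(p_{ij}(x))_{ij\in T}$, where $x\in\mathbb{C}^{n-3}$ satisfies $p_{ij}(x)\ne0$ for all $ij\in T$. Critical points of $L_T$ are the points of $X_T$ where all partial derivatives of $L_T$ with respect to $x_1,\dots,x_{n-3}$ vanish.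 "General $s$" means $s$ outside a proper Zariski closed subset of $\mathbb{C}^{m}$. The matrix $H_T$. Its columns are indexed by the edges in $T$. For the triangle on $\{1,2,3\}$ (that is, $n=4$, $T=\{13,23\}$), with columns ordered $13,23$, $$H_T=\begin{bmatrix}1&0\\0&1\\-1&-1\end{bmatrix}.$$ For $k\ge4$, if $T'$ is a 2-tree on $[k]$ whose last vertex $k$ is joined to $i$ and $j$, and $T=T'\setminus\{ik,jk\}$ (a 2-tree on $[k-1]$), then $$H_{T'}=\begin{bmatrix}H_T&\mathbf{h}_{ij}&\mathbf{h}_{ij}\\ \mathbf{0}&1&0\\ \mathbf{0}&0&1\\ \mathbf{0}&-1&-1\end{bmatrix},$$ where the last two columns are indexed by $ik$ and $jk$, $\mathbf{0}$ is a zero row vector, and $\mathbf{h}_{ij}$ is the column of $H_T$ indexed by the edge $ij$, with the convention that $\mathbf{h}_{12}$ is the zero column. Notation $\lambda\star(Hs)^H$. For an integer matrix $H=(h_{re})$ with $\ell$ rows and $m$ columns and a column vector $s$ of length $m$, $(Hs)^H$ is the vector of length $m$ whose $e$-th entry is $\prod_{r=1}^{\ell}\big((Hs)_r\big)^{h_{re}}$, and $\star$ is the Hadamard (entrywise) product. Horn matrix. For a very affine variety $X\subset(\mathbb{C}^* )^m$, an integer $\ell\times m$ matrix $H=(h_{re})$ is a Horn matrix of $X$ if its column sums are zero and there is $\lambda\in(\mathbb{C}^* )^m$ such that the monomial map $(\mathbb{C}^* )^\ell\to(\mathbb{C}^* )^m$, $q\mapsto\big(\lambda_e\prod_{r=1}^\ell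 q_r^{h_{re}}\big)_{e=1,\dots,m}$, maps $\Delta_A\cap(\mathbb{C}^* )^\ell$ dominantly onto $X$. Here $A$ is an integer matrix with $\ell$ columns whose rows form a basis of the left kernel lattice $\{a\in\mathbb{Z}^{\ell}:aH=0\}$, $X_A\subset\mathbb{P}^{\ell-1}$ is the projective toric variety obtained as the closure of the image of the torus under the monomials whose exponent vectors are the columns of $A$, and $\Delta_A\subset\mathbb{C}^\ell$ (the $A$-discriminantal variety) is the affine cone over the projective dual variety of $X_A$. *)

theory Defs
  imports "HOL-Analysis.Analysis" "HOL-Library.Function_Algebras"
begin

section \<open>Affine varieties\<close>

text \<open>
  For a finite index set \<open>I\<close>, the space $\mathbb{C}^I$ is realised as the set of functions on the
  ambient index type that vanish outside \<open>I\<close>.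
\<close>

definition cspace :: "'i set \<Rightarrow> ('i \<Rightarrow> complex) set" where
  "cspace I = {x. \<forall>i. i \<notin> I \<longrightarrow> x i = 0}"

definition ctorus :: "'i set \<Rightarrow> ('i \<Rightarrow> complex) set" where
  "ctorus I = {x \<in> cspace I. \<forall>i\<in>I. x i \<noteq> 0}"

text \<open>
  Polynomials in the variables indexed by \<open>I\<close>, given as functions. As \<open>\<complex>\<close> is infinite, a
  polynomial is determined by its function.
\<close>

inductive_set poly_funs :: "'i set \<Rightarrow> (('i \<Rightarrow> complex) \<Rightarrow> complex) set" for I where
  const: "(\<lambda>x. c) \<in> poly_funs I"
| coord: "i \<in> I \<Longrightarrow> (\<lambda>x. x i) \<in> poly_funs I"
| add: "f \<in> poly_funs I \<Longrightarrow> g \<in> poly_funs I \<Longrightarrow> (\<lambda>x. f x + g x) \<in> poly_funs I"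
| mult: "f \<in> poly_funs I \<Longrightarrow> g \<in> poly_funs I \<Longrightarrow> (\<lambda>x. f x * g x) \<in> poly_funs I"

definition zariski_closed :: "'i set \<Rightarrow> ('i \<Rightarrow> complex) set \<Rightarrow> bool" where
  "zariski_closed I Z \<longleftrightarrow> (\<exists>F \<subseteq> poly_funs I. Z = {x \<in> cspace I. \<forall>f\<in>F. f x = 0})"

definition zariski_closure :: "'i set \<Rightarrow> ('i \<Rightarrow> complex) set \<Rightarrow> ('i \<Rightarrow> complex) set" where
  "zariski_closure I S =
     {x \<in> cspace I. \<forall>f\<in>poly_funs I. (\<forall>y\<in>S. f y = 0) \<longrightarrow> f x = 0}"

definition for_general :: "'i set \<Rightarrow> (('i \<Rightarrow> complex) \<Rightarrow> bool) \<Rightarrow> bool" where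
  "for_general I P \<longleftrightarrow>
     (\<exists>Z. zariski_closed I Z \<and> Z \<noteq> cspace I \<and> (\<forall>s \<in> cspace I - Z. P s))"

definition tangent_space ::
  "'i set \<Rightarrow> ('i \<Rightarrow> complex) set \<Rightarrow> ('i \<Rightarrow> complex) \<Rightarrow> ('i \<Rightarrow> complex) set" where
  "tangent_space I V x =
     {v \<in> cspace I. \<forall>f\<in>poly_funs I. (\<forall>z\<in>V. f z = 0) \<longrightarrow>
        deriv (\<lambda>t. f (\<lambda>i. x i + t * v i)) 0 = 0}"

text \<open>
  The dimension is the transcendence degree of the coordinate ring. Since the coordinate functions
  generate that ring, it is the largest number of coordinate functions that are algebraically
  independent on the variety.
\<close>

definition variety_dim :: "'i set \<Rightarrow> ('i \<Rightarrow> complex) set \<Rightarrow> nat" where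
  "variety_dim I V =
     Max {card J | J. J \<subseteq> I \<and>
       (\<forall>f\<in>poly_funs J. (\<forall>x\<in>V. f x = 0) \<longrightarrow> (\<forall>x. f x = 0))}"

definition smooth_point :: "'i set \<Rightarrow> ('i \<Rightarrow> complex) set \<Rightarrow> ('i \<Rightarrow> complex) \<Rightarrow> bool" where
  "smooth_point I V x \<longleftrightarrow>
     x \<in> V \<and>
     vector_space.dim (\<lambda>(c::complex) v i. c * v i) (tangent_space I V x) = variety_dim I V"

section \<open>Projective varieties and discriminants\<close>

text \<open>
  A subset of the projective space with homogeneous coordinates indexed by \<open>I\<close> is represented by
  vectors of homogeneous coordinates of its points, and a projective variety by the set of all such
  (nonzero) vectors.
\<close>

definition homogeneous :: "'i set \<Rightarrow> (('i \<Rightarrow> complex) \<Rightarrow> complex) \<Rightarrow> bool" where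
  "homogeneous I f \<longleftrightarrow>
     f \<in> poly_funs I \<and> (\<exists>d. \<forall>c x. f (\<lambda>i. c * x i) = c ^ d * f x)"

definition proj_closure :: "'i set \<Rightarrow> ('i \<Rightarrow> complex) set \<Rightarrow> ('i \<Rightarrow> complex) set" where
  "proj_closure I S =
     {x \<in> cspace I - {0}. \<forall>f. homogeneous I f \<and> (\<forall>y\<in>S. f y = 0) \<longrightarrow> f x = 0}"

definition affine_cone :: "('i \<Rightarrow> complex) set \<Rightarrow> ('i \<Rightarrow> complex) set" where
  "affine_cone X = insert 0 X"

text \<open>
  The closure of the set of hyperplanes that contain the embedded tangent space at some smooth
  point. Smoothness and tangent space at a point of \<open>X\<close> are those of the affine cone at any of its
  nonzero representatives; hyperplanes are given by their coefficient vectors.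
\<close>

definition proj_dual :: "'i set \<Rightarrow> ('i \<Rightarrow> complex) set \<Rightarrow> ('i \<Rightarrow> complex) set" where
  "proj_dual I X = proj_closure I
     {y \<in> cspace I - {0}. \<exists>x\<in>X. smooth_point I (affine_cone X) x \<and>
        (\<forall>v \<in> tangent_space I (affine_cone X) x. (\<Sum>i\<in>I. y i * v i) = 0)}"

text \<open>
  In the following, \<open>A k r\<close> with \<open>k < d\<close> and \<open>r \<in> R\<close> are the entries of an integer matrix with \<open>d\<close>
  rows and with columns indexed by \<open>R\<close>.
\<close>

definition toric_variety :: "'r set \<Rightarrow> nat \<Rightarrow> (nat \<Rightarrow> 'r \<Rightarrow> int) \<Rightarrow> ('r \<Rightarrow> complex) set" where
  "toric_variety R d A = proj_closure R
     ((\<lambda>t r. if r \<in> R then \<Prod>k<d. t k powi A k r else 0) ` ctorus {..<d})"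

definition discriminantal_variety ::
  "'r set \<Rightarrow> nat \<Rightarrow> (nat \<Rightarrow> 'r \<Rightarrow> int) \<Rightarrow> ('r \<Rightarrow> complex) set" where
  "discriminantal_variety R d A = affine_cone (proj_dual R (toric_variety R d A))"

section \<open>Horn matrices\<close>

text \<open>
  \<open>H r e\<close> with \<open>r \<in> R\<close> and \<open>e \<in> E\<close> are the entries of an integer matrix with rows indexed by \<open>R\<close> and
  columns indexed by \<open>E\<close>.
\<close>

definition left_kernel :: "'r set \<Rightarrow> 'e set \<Rightarrow> ('r \<Rightarrow> 'e \<Rightarrow> int) \<Rightarrow> ('r \<Rightarrow> int) set" where
  "left_kernel R E H =
     {a. (\<forall>r. r \<notin> R \<longrightarrow> a r = 0) \<and> (\<forall>e\<in>E. (\<Sum>r\<in>R. a r * H r e) = 0)}"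

definition lattice_basis :: "nat \<Rightarrow> (nat \<Rightarrow> 'r \<Rightarrow> int) \<Rightarrow> ('r \<Rightarrow> int) set \<Rightarrow> bool" where
  "lattice_basis d A L \<longleftrightarrow>
     (\<forall>k<d. A k \<in> L) \<and>
     (\<forall>a\<in>L. \<exists>!c :: nat \<Rightarrow> int. (\<forall>k\<ge>d. c k = 0) \<and> a = (\<lambda>r. \<Sum>k<d. c k * A k r))"

definition mat_vec ::
  "'r set \<Rightarrow> 'e set \<Rightarrow> ('r \<Rightarrow> 'e \<Rightarrow> int) \<Rightarrow> ('e \<Rightarrow> complex) \<Rightarrow> 'r \<Rightarrow> complex" where
  "mat_vec R E H s = (\<lambda>r. if r \<in> R then \<Sum>e\<in>E. of_int (H r e) * s e else 0)"

text \<open>The vector $\lambda \star q^H$.\<close>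

definition monomial_map ::
  "'r set \<Rightarrow> 'e set \<Rightarrow> ('e \<Rightarrow> complex) \<Rightarrow> ('r \<Rightarrow> 'e \<Rightarrow> int) \<Rightarrow> ('r \<Rightarrow> complex) \<Rightarrow> 'e \<Rightarrow> complex"
  where
  "monomial_map R E lam H q = (\<lambda>e. if e \<in> E then lam e * (\<Prod>r\<in>R. q r powi H r e) else 0)"

text \<open>
  The toric variety depends only on the lattice spanned by the rows of \<open>A\<close>, so the choice of the
  basis is immaterial.
\<close>

definition is_horn_matrix ::
  "'r set \<Rightarrow> 'e set \<Rightarrow> ('r \<Rightarrow> 'e \<Rightarrow> int) \<Rightarrow> ('e \<Rightarrow> complex) set \<Rightarrow> bool" where
  "is_horn_matrix R E H X \<longleftrightarrow>
     (\<forall>e\<in>E. (\<Sum>r\<in>R. H r e) = 0) \<and>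
     (\<exists>lam \<in> ctorus E. \<exists>d A.
        lattice_basis d A (left_kernel R E H) \<and>
        (let Y = monomial_map R E lam H ` (discriminantal_variety R d A \<inter> ctorus R)
         in Y \<subseteq> X \<and> X \<subseteq> zariski_closure E Y))"

section \<open>2-trees\<close>

text \<open>
  An edge joining \<open>i\<close> and \<open>j\<close> is the pair \<open>(i, j)\<close> with \<open>i < j\<close>. \<open>two_tree k T\<close> means that \<open>T\<close> is the
  set of edges other than \<open>(1, 2)\<close> of a 2-tree on the vertices \<open>1, \<dots>, k\<close>.
\<close>

type_synonym edge = "nat \<times> nat"

inductive two_tree :: "nat \<Rightarrow> edge set \<Rightarrow> bool" where
  base: "two_tree 2 {}"
| step: "two_tree k T \<Longrightarrow> (i, j) \<in> insert (1, 2) T \<Longrightarrow>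
    two_tree (Suc k) (T \<union> {(i, Suc k), (j, Suc k)})"

lemma two_tree_bounds: "two_tree k T \<Longrightarrow> k \<ge> 2 \<and> (\<forall>(i, j) \<in> insert (1,2) T. 1 \<le> i \<and> i < j \<and> j \<le> k)"
  by (induction rule: two_tree.induct) (fastforce)+

lemma card_two_tree: "two_tree k T \<Longrightarrow> finite T \<and> card T = 2 * k - 4"
proof (induction rule: two_tree.induct)
  case base then show ?case by simp
next
  case (step k T i j)
  have b: "k \<ge> 2" "i < j" "(i, Suc k) \<notin> T" "(j, Suc k) \<notin> T"
    using two_tree_bounds[OF step(1)] step(2) by force+
  show ?case using b step.IH by (simp add: card_insert_if)
qed

text \<open>
  \<open>tree_matrix k T\<close> is the matrix $H_T$ of a 2-tree on the vertices \<open>1, \<dots>, k\<close> with \<open>k \<ge> 3\<close>; its rows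
  are indexed by \<open>{1..3 * k - 6}\<close> and its columns by \<open>T\<close>. The two neighbours of the last vertex are
  recovered from \<open>T\<close>.
\<close>

definition neighbours_below :: "edge set \<Rightarrow> nat \<Rightarrow> nat set" where
  "neighbours_below T k = {a. (a, k) \<in> T}"

fun tree_matrix :: "nat \<Rightarrow> edge set \<Rightarrow> nat \<Rightarrow> edge \<Rightarrow> int" where
  "tree_matrix k T =
    (if k \<le> 3 then
       (\<lambda>r e. if r = 1 \<and> e = (1, 3) then 1
              else if r = 2 \<and> e = (2, 3) then 1
              else if r = 3 \<and> e \<in> {(1, 3), (2, 3)} then -1
              else 0)
     else
       (let i = Min (neighbours_below T k);
            j = Max (neighbours_below T k);
            H = tree_matrix (k - 1) (T - {(i, k), (j, k)});
            h = (\<lambda>r. if (i, j) = (1, 2) then 0 else H r (i, j));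
            b = 3 * k - 9
        in (\<lambda>r e.
              if r \<le> b then (if e \<in> {(i, k), (j, k)} then h r else H r e)
              else if r = b + 1 then (if e = (i, k) then 1 else 0)
              else if r = b + 2 then (if e = (j, k) then 1 else 0)
              else if r = b + 3 then (if e \<in> {(i, k), (j, k)} then -1 else 0)
              else 0)))"

declare tree_matrix.simps [simp del]

lemma tree_matrix_step:
  assumes "two_tree k T" "k \<ge> 3" "(i, j) \<in> insert (1, 2) T"
  shows "tree_matrix (Suc k) (T \<union> {(i, Suc k), (j, Suc k)}) =
    (\<lambda>r e. if r \<le> 3 * k - 6 then
             (if e \<in> {(i, Suc k), (j, Suc k)}
              then (if (i, j) = (1, 2) then 0 else tree_matrix k T r (i, j))
              else tree_matrix k T r e)
           else if r = 3 * k - 5 then (if e = (i, Suc k) then 1 else 0)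
           else if r = 3 * k - 4 then (if e = (j, Suc k) then 1 else 0)
           else if r = 3 * k - 3 then (if e \<in> {(i, Suc k), (j, Suc k)} then -1 else 0)
           else 0)"
proof -
  have ij: "i < j" "(i, Suc k) \<notin> T" "(j, Suc k) \<notin> T" "\<And>a. (a, Suc k) \<notin> T"
    using two_tree_bounds[OF assms(1)] assms(3) by force+
  have nb: "neighbours_below (T \<union> {(i, Suc k), (j, Suc k)}) (Suc k) = {i, j}"
    using ij(4) by (auto simp: neighbours_below_def)
  have mm: "Min {i, j} = i" "Max {i, j} = j" using ij(1) by auto
  have d: "T \<union> {(i, Suc k), (j, Suc k)} - {(i, Suc k), (j, Suc k)} = T" using ij by auto
  have ar: "3 * Suc k - 9 = 3 * k - 6" "3 * k - 6 + 1 = 3 * k - 5" "3 * k - 6 + 2 = 3 * k - 4"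
    "3 * k - 6 + 3 = 3 * k - 3" using assms(2) by auto
  show ?thesis
    by (subst tree_matrix.simps, unfold nb mm d Let_def ar diff_Suc_1) (use assms(2) in simp)
qed

section \<open>Scattering potentials\<close>

definition ycoord :: "(nat \<Rightarrow> complex) \<Rightarrow> nat \<Rightarrow> complex" where
  "ycoord x j = (if j = 1 then 0 else if j = 2 then 1 else x (j - 2))"

definition pcoord :: "(nat \<Rightarrow> complex) \<Rightarrow> edge \<Rightarrow> complex" where
  "pcoord x = (\<lambda>(i, j). ycoord x j - ycoord x i)"

definition pvec :: "edge set \<Rightarrow> (nat \<Rightarrow> complex) \<Rightarrow> edge \<Rightarrow> complex" where
  "pvec T x = (\<lambda>e. if e \<in> T then pcoord x e else 0)"

definition config_space :: "nat \<Rightarrow> edge set \<Rightarrow> (nat \<Rightarrow> complex) set" where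
  "config_space n T = {x \<in> cspace {1..n - 3}. \<forall>e\<in>T. pcoord x e \<noteq> 0}"

definition tree_variety :: "nat \<Rightarrow> edge set \<Rightarrow> (edge \<Rightarrow> complex) set" where
  "tree_variety n T = pvec T ` config_space n T"

definition log_branch :: "complex set \<Rightarrow> (complex \<Rightarrow> complex) \<Rightarrow> bool" where
  "log_branch U l \<longleftrightarrow> open U \<and> l holomorphic_on U \<and> (\<forall>z\<in>U. exp (l z) = z)"

text \<open>
  The potential is multivalued; \<open>l e\<close> is the branch of the logarithm used in the term of the edge
  \<open>e\<close>. Its partial derivatives do not depend on the choice of the branches.
\<close>

definition potential ::
  "edge set \<Rightarrow> (edge \<Rightarrow> complex) \<Rightarrow> (edge \<Rightarrow> complex \<Rightarrow> complex) \<Rightarrow> (nat \<Rightarrow> complex) \<Rightarrow> complex"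
  where
  "potential T s l x = (\<Sum>e\<in>T. s e * l e (pcoord x e))"

definition is_critical ::
  "nat \<Rightarrow> edge set \<Rightarrow> (edge \<Rightarrow> complex) \<Rightarrow> (nat \<Rightarrow> complex) \<Rightarrow> bool" where
  "is_critical n T s x \<longleftrightarrow>
     (\<exists>U l. (\<forall>e\<in>T. log_branch (U e) (l e) \<and> pcoord x e \<in> U e) \<and>
        (\<forall>k\<in>{1..n - 3}.
           ((\<lambda>t. potential T s l (x(k := t))) has_field_derivative 0) (at (x k))))"

definition critical_points ::
  "nat \<Rightarrow> edge set \<Rightarrow> (edge \<Rightarrow> complex) \<Rightarrow> (edge \<Rightarrow> complex) set" where
  "critical_points n T s = pvec T ` {x \<in> config_space n T. is_critical n T s x}"

end

theory Submission
  imports Defs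
begin

text \<open>
  The rows of $H_T$ come in triples, one for each vertex $v \ge 3$ of the tree. If $v$ was joined to
  the edge $ij$ then the columns $iv$ and $jv$ are equal outside the triple of $v$, and inside it they
  are $(1, 0, -1)$ and $(0, 1, -1)$. Everything follows from this by induction on the tree.

  \<^bold>\<open>The discriminant is linear.\<close> An integer vector in the left kernel of $H_T$ pairs to
  zero with the column of $ij$; pairing it with the columns $iv$ and $jv$ then shows that its three
  entries at $v$ agree (lemma \<open>tree_matrix_orthogonal_iff\<close>). So the left kernel consists of
  the vectors that are constant on every triple, a basis \<open>A\<close> of it is given by the indicator
  vectors of the triples, and $X_A$ is a linear space. The dual variety of a linear space is its
  orthogonal complement: $\Delta_A$ is the set of all $q$ whose entries sum to zero on every triple
  (lemma \<open>discriminantal_variety_block_matrix\<close>).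

  \<^bold>\<open>Triangle relations.\<close> Choose signs recursively by $\lambda_{12} = 1$,
  $\lambda_{iv} = -\lambda_{ij}$, $\lambda_{jv} = \lambda_{ij}$. If $(a, b, c)$ are the entries of $q$
  in the triple of $v$, the monomials $p = \lambda \star q^H$ satisfy $p_{iv} = -p_{ij} a / c$ and
  $p_{jv} = p_{ij} b / c$. The relation $p_{iv} - p_{jv} = p_{ij}$, which expresses that the three
  entries of $p$ are differences of coordinates of the points $i$, $j$, $v$, becomes $a + b + c = 0$.
  Hence the monomial map sends $\Delta_A \cap (\mathbb{C}^*)^\ell$ into $X_T$, and even onto it
  (lemmas \<open>tree_monomial_imp_edge_diff\<close> and \<open>edge_diff_imp_tree_monomial\<close>).

  \<^bold>\<open>Critical points.\<close> The position $y_v$ of the last vertex occurs in two terms of the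
  potential. Its critical equation $s_{iv}/p_{iv} + s_{jv}/p_{jv} = 0$ gives
  $p_{iv} = p_{ij} s_{iv} / (s_{iv} + s_{jv})$, and after its elimination the remaining equations are
  those of the smaller tree with $s_{ij}$ replaced by $s_{ij} + s_{iv} + s_{jv}$. The same substitution
  describes the upper rows of $H_T s$, while the lower rows are
  $(s_{iv}, s_{jv}, -s_{iv} - s_{jv})$. So the recursion for the critical point is the recursion of the
  monomials evaluated at $q = H_T s$ (lemma \<open>vertex_force_iff_tree_monomial\<close>). The argument
  works as soon as no entry of $H_T s$ vanishes, which is a nonempty open condition because it holds
  when all $s_e$ have positive real part.
\<close>

section \<open>Polynomial functions\<close>

lemma poly_funs_sum:
  "finite A \<Longrightarrow> (\<And>a. a \<in> A \<Longrightarrow> f a \<in> poly_funs I) \<Longrightarrow> (\<lambda>x. \<Sum>a\<in>A. f a x) \<in> poly_funs I"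
  by (induction rule: finite_induct) (auto intro: poly_funs.intros)

lemma poly_funs_prod:
  "finite A \<Longrightarrow> (\<And>a. a \<in> A \<Longrightarrow> f a \<in> poly_funs I) \<Longrightarrow> (\<lambda>x. \<Prod>a\<in>A. f a x) \<in> poly_funs I"
  by (induction rule: finite_induct) (auto intro: poly_funs.intros)

lemma poly_funs_cong:
  "f \<in> poly_funs I \<Longrightarrow> (\<And>i. i \<in> I \<Longrightarrow> x i = y i) \<Longrightarrow> f x = f y"
  by (induction rule: poly_funs.induct) auto

lemma homogeneous_linear:
  assumes "finite A" "A \<subseteq> I"
  shows "homogeneous I (\<lambda>x. \<Sum>i\<in>A. c i * x i)"
proof -
  have "(\<lambda>x. \<Sum>i\<in>A. c i * x i) \<in> poly_funs I"
    using assms by (intro poly_funs_sum poly_funs.intros) auto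
  moreover have "(\<Sum>i\<in>A. c i * (b * x i)) = b ^ 1 * (\<Sum>i\<in>A. c i * x i)" for b and x :: "_ \<Rightarrow> complex"
    by (simp add: sum_distrib_left algebra_simps)
  ultimately show ?thesis unfolding homogeneous_def by blast
qed

lemma homogeneous_diff: "r \<in> I \<Longrightarrow> r' \<in> I \<Longrightarrow> homogeneous I (\<lambda>x. x r + (-1) * x r')"
  unfolding homogeneous_def
  by (intro conjI poly_funs.intros exI[of _ 1]) (auto simp: algebra_simps)

lemma isCont_poly_funs_line:
  "f \<in> poly_funs I \<Longrightarrow> isCont (\<lambda>t. f (\<lambda>i. x i + t * v i)) t0"
  by (induction rule: poly_funs.induct) (auto intro!: continuous_intros)

text \<open>
  Applied to the restriction of a polynomial to a line, this shows that a polynomial that vanishes on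
  the points of the line inside the torus vanishes also on the other ones.
\<close>
lemma isCont_zero_at:
  fixes g :: "complex \<Rightarrow> complex"
  assumes "isCont g 0" "finite F" "\<And>t. t \<notin> F \<Longrightarrow> g t = 0"
  shows "g 0 = 0"
proof -
  have "\<forall>\<^sub>F t in at 0. t \<in> - (F - {0})"
  proof -
    have "open (- (F - {0}))"
      using assms(2) by (intro open_Compl finite_imp_closed finite_Diff)
    then show ?thesis by (rule eventually_at_in_open') simp
  qed
  then have "\<forall>\<^sub>F t in at 0. g t = 0"
    using eventually_neq_at_within[of 0 0 UNIV]
    by eventually_elim (use assms(3) in auto)
  then have "(g \<longlongrightarrow> 0) (at 0)" by (simp add: tendsto_eventually)
  moreover have "(g \<longlongrightarrow> g 0) (at 0)" using assms(1) by (simp add: isCont_def)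
  ultimately show ?thesis by (simp add: LIM_unique)
qed

section \<open>Discriminants of partition matrices\<close>

text \<open>The complex vector space structure that the definition of smooth points refers to.\<close>

interpretation cfun: vector_space "\<lambda>(c::complex) v i. c * v i"
  by unfold_locales (auto simp: fun_eq_iff algebra_simps)

text \<open>
  A partition of the index set \<open>R\<close> into the nonempty blocks on which \<open>\<beta>\<close> is constant. The rows
  of \<open>block_matrix\<close> are the indicator vectors of the blocks.
\<close>

locale row_partition =
  fixes R :: "'r set" and d :: nat and \<beta> :: "'r \<Rightarrow> nat"
  assumes finite_rows: "finite R" and image_\<beta>: "\<beta> ` R = {..<d}" and d_pos: "d > 0"
begin

definition block_matrix :: "nat \<Rightarrow> 'r \<Rightarrow> int" where
  "block_matrix k r = of_bool (r \<in> R \<and> \<beta> r = k)"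

definition block_constant :: "('r \<Rightarrow> complex) set" where
  "block_constant = {x \<in> cspace R. \<forall>r\<in>R. \<forall>r'\<in>R. \<beta> r = \<beta> r' \<longrightarrow> x r = x r'}"

lemma block_constantD:
  "x \<in> block_constant \<Longrightarrow> r \<in> R \<Longrightarrow> r' \<in> R \<Longrightarrow> \<beta> r = \<beta> r' \<Longrightarrow> x r = x r'"
  unfolding block_constant_def by blast

lemma block_constant_cspace: "x \<in> block_constant \<Longrightarrow> x \<in> cspace R"
  unfolding block_constant_def by blast

definition rep :: "nat \<Rightarrow> 'r" where
  "rep k = (SOME r. r \<in> R \<and> \<beta> r = k)"

lemma rep: "k < d \<Longrightarrow> rep k \<in> R" "k < d \<Longrightarrow> \<beta> (rep k) = k"
proof -
  have "\<exists>r. r \<in> R \<and> \<beta> r = k" if "k < d" using image_\<beta> that by (metis imageE lessThan_iff)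
  then have "k < d \<Longrightarrow> rep k \<in> R \<and> \<beta> (rep k) = k" unfolding rep_def by (metis (mono_tags, lifting) someI_ex)
  then show "k < d \<Longrightarrow> rep k \<in> R" "k < d \<Longrightarrow> \<beta> (rep k) = k" by auto
qed

lemma \<beta>_less: "r \<in> R \<Longrightarrow> \<beta> r < d"
  using image_\<beta> by auto

definition block_vec :: "(nat \<Rightarrow> complex) \<Rightarrow> 'r \<Rightarrow> complex" where
  "block_vec c r = (if r \<in> R then c (\<beta> r) else 0)"

lemma block_constant_eq: "block_constant = range block_vec"
proof (intro equalityI subsetI)
  fix x assume x: "x \<in> block_constant"
  have "x r = block_vec (\<lambda>k. x (rep k)) r" for r
  proof (cases "r \<in> R")
    case True
    then have "x (rep (\<beta> r)) = x r"
      using x rep[OF \<beta>_less[OF True]] unfolding block_constant_def by blast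
    then show ?thesis using True by (simp add: block_vec_def)
  qed (use x in \<open>simp add: block_vec_def block_constant_def cspace_def\<close>)
  then have "x = block_vec (\<lambda>k. x (rep k))" by (rule ext)
  then show "x \<in> range block_vec" by blast
qed (auto simp: block_constant_def block_vec_def cspace_def)

lemma lattice_basis_block_matrix:
  "lattice_basis d block_matrix
     {a. (\<forall>r. r \<notin> R \<longrightarrow> a r = 0) \<and> (\<forall>r\<in>R. \<forall>r'\<in>R. \<beta> r = \<beta> r' \<longrightarrow> a r = a r')}"
  unfolding lattice_basis_def
proof (intro conjI allI impI ballI)
  fix a :: "'r \<Rightarrow> int"
  assume a: "a \<in> {a. (\<forall>r. r \<notin> R \<longrightarrow> a r = 0) \<and> (\<forall>r\<in>R. \<forall>r'\<in>R. \<beta> r = \<beta> r' \<longrightarrow> a r = a r')}"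
  have comb: "(\<Sum>k<d. c k * block_matrix k r) = (if r \<in> R then c (\<beta> r) else 0)" for c r
  proof (cases "r \<in> R")
    case True
    have "(\<Sum>k<d. c k * block_matrix k r) = (\<Sum>k<d. if k = \<beta> r then c k else 0)"
      using True by (intro sum.cong) (auto simp: block_matrix_def)
    then show ?thesis using True \<beta>_less[of r] by simp
  qed (simp add: block_matrix_def)
  show "\<exists>!c. (\<forall>k\<ge>d. c k = 0) \<and> a = (\<lambda>r. \<Sum>k<d. c k * block_matrix k r)"
    unfolding comb
  proof (rule ex1I[of _ "\<lambda>k. if k < d then a (rep k) else 0"])
    have "a r = (if r \<in> R then if \<beta> r < d then a (rep (\<beta> r)) else 0 else 0)" for r
    proof (cases "r \<in> R")
      case True
      then have "a (rep (\<beta> r)) = a r" using a rep[OF \<beta>_less[OF True]] by blast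
      then show ?thesis using True \<beta>_less[OF True] by simp
    qed (use a in simp)
    then show "(\<forall>k\<ge>d. (if k < d then a (rep k) else 0) = 0) \<and>
      a = (\<lambda>r. if r \<in> R then if \<beta> r < d then a (rep (\<beta> r)) else 0 else 0)"
      by (auto simp: fun_eq_iff)
  next
    fix c assume c: "(\<forall>k\<ge>d. c k = 0) \<and> a = (\<lambda>r. if r \<in> R then c (\<beta> r) else 0)"
    then show "c = (\<lambda>k. if k < d then a (rep k) else 0)"
      using rep by (auto simp: fun_eq_iff)
  qed
qed (auto simp: block_matrix_def)

text \<open>
  The monomials of the block matrix are $t \mapsto t_{\beta(r)}$, so the torus parametrises exactly the
  block constant vectors without zero entries. They satisfy the linear equations $x_r = x_{r'}$, and a
  block constant vector $x$ is a limit of such vectors along the line $x + t(1, \dots, 1)$.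
\<close>

lemma toric_variety_block_matrix: "toric_variety R d block_matrix = block_constant - {0}"
proof -
  let ?S = "(\<lambda>t r. if r \<in> R then \<Prod>k<d. t k powi block_matrix k r else 0) ` ctorus {..<d}"
  have mono: "(\<Prod>k<d. t k powi block_matrix k r) = t (\<beta> r)" if "r \<in> R" for t :: "nat \<Rightarrow> complex" and r
  proof -
    have "(\<Prod>k<d. t k powi block_matrix k r) = (\<Prod>k<d. if k = \<beta> r then t k else 1)"
      using that by (intro prod.cong) (auto simp: block_matrix_def)
    then show ?thesis using that \<beta>_less[of r] by simp
  qed
  have S: "?S = block_vec ` ctorus {..<d}"
    by (intro image_cong) (auto simp: block_vec_def mono)
  have "proj_closure R ?S \<subseteq> block_constant - {0}"
  proof
    fix x assume x: "x \<in> proj_closure R ?S"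
    have "x r = x r'" if "r \<in> R" "r' \<in> R" "\<beta> r = \<beta> r'" for r r'
    proof -
      have "x r + (-1) * x r' = 0"
        using x homogeneous_diff[OF that(1,2)] that unfolding S proj_closure_def
        by (fastforce simp: block_vec_def)
      then show ?thesis by simp
    qed
    then show "x \<in> block_constant - {0}"
      using x unfolding block_constant_def proj_closure_def by blast
  qed
  moreover have "f x = 0" if x: "x \<in> block_constant" and f: "f \<in> poly_funs R"
    and van: "\<forall>y\<in>?S. f y = 0" for x f
  proof -
    obtain c where c: "x = block_vec c" using x by (auto simp: block_constant_eq)
    let ?g = "\<lambda>t. f (\<lambda>r. x r + t * block_vec (\<lambda>_. 1) r)"
    have "?g 0 = 0"
    proof (rule isCont_zero_at)
      show "isCont ?g 0" by (rule isCont_poly_funs_line[OF f])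
      \<comment> \<open>At these finitely many \<open>t\<close>, the point \<open>x + t (1, ..., 1)\<close> has a zero entry.\<close>
      show "finite ((\<lambda>k. - c k) ` {..<d})" by simp
      fix t assume t: "t \<notin> (\<lambda>k. - c k) ` {..<d}"
      define u where "u = (\<lambda>k. if k < d then c k + t else 0)"
      have "c k + t \<noteq> 0" if "k < d" for k
        using t that by (metis add_eq_0_iff2 imageI lessThan_iff add.inverse_inverse add_eq_0_iff)
      then have "u \<in> ctorus {..<d}" by (auto simp: u_def ctorus_def cspace_def)
      moreover have "(\<lambda>r. x r + t * block_vec (\<lambda>_. 1) r) = block_vec u"
        using \<beta>_less by (auto simp: c block_vec_def u_def)
      ultimately show "?g t = 0" using van unfolding S by simp
    qed
    then show ?thesis by simp
  qed
  then have "block_constant - {0} \<subseteq> proj_closure R ?S"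
    unfolding proj_closure_def homogeneous_def block_constant_def by blast
  ultimately show ?thesis unfolding toric_variety_def by blast
qed

lemma zero_in_block_constant: "0 \<in> block_constant"
  by (simp add: block_constant_def cspace_def)

lemma tangent_space_block_constant:
  assumes "x \<in> block_constant"
  shows "tangent_space R block_constant x = block_constant"
proof
  show "tangent_space R block_constant x \<subseteq> block_constant"
  proof
    fix v assume v: "v \<in> tangent_space R block_constant x"
    have "v r = v r'" if "r \<in> R" "r' \<in> R" "\<beta> r = \<beta> r'" for r r'
    proof -
      have deriv0: "deriv (\<lambda>t. f (\<lambda>i. x i + t * v i)) 0 = 0"
        if "f \<in> poly_funs R" "\<forall>z\<in>block_constant. f z = 0" for f
        using v that by (simp add: tangent_space_def)
      have "(\<lambda>x. x r + (-1) * x r') \<in> poly_funs R"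
        using homogeneous_diff[OF that(1,2)] by (simp add: homogeneous_def)
      moreover have "\<forall>z\<in>block_constant. z r + (-1) * z r' = 0"
        using block_constantD[OF _ that] by simp
      ultimately have "deriv (\<lambda>t. (x r + t * v r) + (-1) * (x r' + t * v r')) 0 = 0"
        by (rule deriv0)
      moreover have "((\<lambda>t. (x r + t * v r) + (-1) * (x r' + t * v r')) has_field_derivative v r - v r') (at 0)"
        by (auto intro!: derivative_eq_intros)
      ultimately show ?thesis by (metis DERIV_imp_deriv eq_iff_diff_eq_0)
    qed
    then show "v \<in> block_constant"
      using v unfolding block_constant_def tangent_space_def by blast
  qed
  show "block_constant \<subseteq> tangent_space R block_constant x"
  proof
    fix v assume v: "v \<in> block_constant"
    obtain c c' where "x = block_vec c" "v = block_vec c'"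
      using assms v by (auto simp: block_constant_eq)
    then have "(\<lambda>i. x i + t * v i) = block_vec (\<lambda>k. c k + t * c' k)" for t
      by (auto simp: block_vec_def)
    then have "(\<lambda>i. x i + t * v i) \<in> block_constant" for t
      by (simp add: block_constant_eq)
    then show "v \<in> tangent_space R block_constant x"
      using block_constant_cspace[OF v] by (auto simp: tangent_space_def)
  qed
qed

text \<open>
  One coordinate from each block gives an algebraically independent set; two coordinates $r$, $r'$ from
  the same block satisfy the relation $x_r - x_{r'} = 0$.
\<close>

lemma variety_dim_block_constant: "variety_dim R block_constant = d"
proof -
  define indep where "indep J \<longleftrightarrow> J \<subseteq> R \<and>
    (\<forall>f\<in>poly_funs J. (\<forall>x\<in>block_constant. f x = 0) \<longrightarrow> (\<forall>x. f x = 0))" for J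
  have le: "card J \<le> d" if indep: "indep J" for J
  proof -
    note J = indep[unfolded indep_def]
    have "inj_on \<beta> J"
    proof (rule inj_onI, rule ccontr)
      fix r r' assume r: "r \<in> J" "r' \<in> J" "\<beta> r = \<beta> r'" "r \<noteq> r'"
      have poly: "(\<lambda>x. x r + (-1) * x r') \<in> poly_funs J"
        using homogeneous_diff[OF r(1,2)] by (simp add: homogeneous_def)
      have "\<forall>x\<in>block_constant. x r + (-1) * x r' = 0"
      proof
        fix x assume "x \<in> block_constant"
        then have "x r = x r'" using r J by (intro block_constantD) auto
        then show "x r + (-1) * x r' = 0" by simp
      qed
      then have "\<forall>x :: 'r \<Rightarrow> complex. x r + (-1) * x r' = 0"
        using bspec[OF conjunct2[OF J] poly] by (rule rev_mp)
      from spec[OF this, of "\<lambda>i. of_bool (i = r)"] show False using r(4) by simp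
    qed
    then have "card J = card (\<beta> ` J)" by (simp add: card_image)
    also have "\<dots> \<le> card {..<d}" using J image_\<beta> by (intro card_mono) auto
    finally show ?thesis by simp
  qed
  have inj: "inj_on rep {..<d}" using rep(2) by (metis inj_onI lessThan_iff)
  have "indep (rep ` {..<d})"
    unfolding indep_def
  proof (intro conjI ballI impI allI)
    show "rep ` {..<d} \<subseteq> R" using rep(1) by auto
    fix f and x :: "'r \<Rightarrow> complex"
    assume f: "f \<in> poly_funs (rep ` {..<d})" "\<forall>x\<in>block_constant. f x = 0"
    have "f x = f (block_vec (\<lambda>k. x (rep k)))"
      by (rule poly_funs_cong[OF f(1)]) (auto simp: block_vec_def rep)
    then show "f x = 0" using f(2) by (auto simp: block_constant_eq)
  qed
  moreover have "d = card (rep ` {..<d})" using card_image[OF inj] by simp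
  ultimately have mem: "d \<in> {card J | J. indep J}" by blast
  have "finite {card J | J. indep J}" by (rule finite_subset[of _ "{..d}"]) (use le in auto)
  then have "Max {card J | J. indep J} = d" using mem le by (intro Max_eqI) auto
  then show ?thesis unfolding variety_dim_def indep_def .
qed

lemma dim_block_constant: "cfun.dim block_constant = d"
proof -
  define b where "b = (\<lambda>k r. block_vec (\<lambda>k'. of_bool (k' = k)) r)"
  have inj: "inj_on b {..<d}"
  proof (rule inj_onI)
    fix k k' assume "k \<in> {..<d}" "k' \<in> {..<d}" "b k = b k'"
    then have "b k (rep k) = b k' (rep k)" by simp
    then show "k = k'" using \<open>k \<in> {..<d}\<close> rep by (auto simp: b_def block_vec_def split: if_splits)
  qed
  have sum_b: "(\<Sum>k<d. c k * b k r) = block_vec c r" for c r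
  proof (cases "r \<in> R")
    case True
    have "(\<Sum>k<d. c k * b k r) = (\<Sum>k<d. if k = \<beta> r then c k else 0)"
      using True by (intro sum.cong) (auto simp: b_def block_vec_def)
    then show ?thesis using True \<beta>_less[of r] by (simp add: block_vec_def)
  qed (simp add: b_def block_vec_def)
  have sum_fun: "(\<Sum>a\<in>A. g a) = (\<lambda>r. \<Sum>a\<in>A. g a r)" for g :: "'x \<Rightarrow> 'r \<Rightarrow> complex" and A
    by (induction A rule: infinite_finite_induct) auto
  have "cfun.dim block_constant = card (b ` {..<d})"
  proof (rule cfun.dim_unique)
    show "b ` {..<d} \<subseteq> block_constant" by (auto simp: b_def block_constant_eq)
    show "block_constant \<subseteq> cfun.span (b ` {..<d})"
    proof
      fix x assume "x \<in> block_constant"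
      then obtain c where "x = block_vec c" by (auto simp: block_constant_eq)
      then have "x = (\<Sum>k<d. (\<lambda>r. c k * b k r))" unfolding sum_fun by (simp add: sum_b)
      also have "\<dots> \<in> cfun.span (b ` {..<d})"
        by (intro cfun.span_sum cfun.span_scale cfun.span_base) auto
      finally show "x \<in> cfun.span (b ` {..<d})" .
    qed
    show "cfun.independent (b ` {..<d})"
    proof (rule cfun.independent_if_scalars_zero)
      fix f x assume *: "(\<Sum>x\<in>b ` {..<d}. (\<lambda>i. f x * x i)) = 0" "x \<in> b ` {..<d}"
      then obtain k where k: "k < d" "x = b k" by auto
      have "(\<Sum>x\<in>b ` {..<d}. (\<lambda>i. f x * x i)) = block_vec (\<lambda>k. f (b k))"
        by (simp add: sum.reindex[OF inj] sum_fun sum_b)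
      then have "block_vec (\<lambda>k. f (b k)) (rep k) = 0" using *(1) by (metis zero_fun_apply)
      then show "f x = 0" using k rep by (simp add: block_vec_def)
    qed simp
  qed simp
  then show ?thesis using card_image[OF inj] by simp
qed

text \<open>
  $X_A$ is a linear space, smooth at all its points and equal to its tangent space, so a hyperplane is
  tangent to it if and only if it contains it. The coefficient vectors of these hyperplanes form the
  orthogonal complement, which is closed already.
\<close>

theorem discriminantal_variety_block_matrix:
  "discriminantal_variety R d block_matrix =
     {y \<in> cspace R. \<forall>k<d. (\<Sum>r\<in>{r \<in> R. \<beta> r = k}. y r) = 0}"
proof -
  let ?perp = "{y \<in> cspace R. \<forall>k<d. (\<Sum>r\<in>{r \<in> R. \<beta> r = k}. y r) = 0}"
  have cone: "affine_cone (block_constant - {0}) = block_constant"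
    using zero_in_block_constant by (auto simp: affine_cone_def)
  have smooth: "smooth_point R block_constant x" if "x \<in> block_constant" for x
    using that unfolding smooth_point_def
    by (simp add: tangent_space_block_constant dim_block_constant variety_dim_block_constant)
  have pairing: "(\<Sum>r\<in>R. y r * block_vec c r) = (\<Sum>k<d. c k * (\<Sum>r\<in>{r \<in> R. \<beta> r = k}. y r))" for y c
  proof -
    have "(\<Sum>k<d. c k * (\<Sum>r\<in>{r \<in> R. \<beta> r = k}. y r)) = (\<Sum>k<d. \<Sum>r\<in>{r \<in> R. \<beta> r = k}. y r * block_vec c r)"
      unfolding sum_distrib_left by (intro sum.cong) (auto simp: block_vec_def)
    also have "\<dots> = (\<Sum>r\<in>R. y r * block_vec c r)"
      using image_\<beta> by (intro sum.group finite_rows) auto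
    finally show ?thesis by simp
  qed
  have perp: "(\<forall>v\<in>block_constant. (\<Sum>r\<in>R. y r * v r) = 0) \<longleftrightarrow>
      (\<forall>k<d. (\<Sum>r\<in>{r \<in> R. \<beta> r = k}. y r) = 0)" for y
  proof
    assume *: "\<forall>v\<in>block_constant. (\<Sum>r\<in>R. y r * v r) = 0"
    show "\<forall>k<d. (\<Sum>r\<in>{r \<in> R. \<beta> r = k}. y r) = 0"
    proof (intro allI impI)
      fix k assume "k < d"
      have "(\<Sum>k'<d. of_bool (k' = k) * (\<Sum>r\<in>{r \<in> R. \<beta> r = k'}. y r)) = 0"
        using * pairing[of y "\<lambda>k'. of_bool (k' = k)"] by (auto simp: block_constant_eq)
      moreover have "(\<Sum>k'<d. of_bool (k' = k) * (\<Sum>r\<in>{r \<in> R. \<beta> r = k'}. y r)) =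
        (\<Sum>k'<d. if k' = k then \<Sum>r\<in>{r \<in> R. \<beta> r = k'}. y r else 0)"
        by (intro sum.cong) auto
      ultimately show "(\<Sum>r\<in>{r \<in> R. \<beta> r = k}. y r) = 0" using \<open>k < d\<close> by simp
    qed
  qed (auto simp: block_constant_eq pairing)
  \<comment> \<open>A nonzero smooth point at which the orthogonality condition can be tested.\<close>
  have "block_vec (\<lambda>_. 1) \<in> block_constant - {0}"
  proof -
    have "block_vec (\<lambda>_. 1) (rep 0) \<noteq> 0" using rep d_pos by (simp add: block_vec_def)
    then have "block_vec (\<lambda>_. 1) \<noteq> 0" by (metis zero_fun_apply)
    then show ?thesis by (auto simp: block_constant_eq)
  qed
  then have normals: "{y \<in> cspace R - {0}. \<exists>x\<in>block_constant - {0}.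
      smooth_point R block_constant x \<and>
      (\<forall>v\<in>tangent_space R block_constant x. (\<Sum>i\<in>R. y i * v i) = 0)} = ?perp - {0}"
    using smooth by (auto simp: tangent_space_block_constant perp)
  have "proj_closure R (?perp - {0}) = ?perp - {0}"
  proof
    show "proj_closure R (?perp - {0}) \<subseteq> ?perp - {0}"
    proof
      fix x assume x: "x \<in> proj_closure R (?perp - {0})"
      have "(\<Sum>r\<in>{r \<in> R. \<beta> r = k}. x r) = 0" if "k < d" for k
      proof -
        have "homogeneous R (\<lambda>x. \<Sum>r\<in>{r \<in> R. \<beta> r = k}. 1 * x r)"
          using finite_rows by (intro homogeneous_linear) auto
        moreover have "\<forall>y\<in>?perp - {0}. (\<Sum>r\<in>{r \<in> R. \<beta> r = k}. 1 * y r) = 0" using that by simp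
        ultimately have "(\<Sum>r\<in>{r \<in> R. \<beta> r = k}. 1 * x r) = 0" using x unfolding proj_closure_def by blast
        then show ?thesis by simp
      qed
      then show "x \<in> ?perp - {0}" using x unfolding proj_closure_def by blast
    qed
    show "?perp - {0} \<subseteq> proj_closure R (?perp - {0})" unfolding proj_closure_def by blast
  qed
  then have "proj_dual R (toric_variety R d block_matrix) = ?perp - {0}"
    unfolding proj_dual_def toric_variety_block_matrix cone normals .
  moreover have "0 \<in> ?perp" by (simp add: cspace_def)
  ultimately show ?thesis
    unfolding discriminantal_variety_def affine_cone_def by (simp add: insert_absorb)
qed

end

section \<open>Edges and signs of a 2-tree\<close>

text \<open>
  Keeps the names $(1, 2)$ of the root edge and $T \cup \{ik, jk\}$ of the extended tree intact under
  simplification.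
\<close>

declare One_nat_def [simp del] Un_insert_right [simp del]

lemma two_tree_edge:
  assumes "two_tree k T" "(i, j) \<in> insert (1, 2) T"
  shows "1 \<le> i" "i < j" "j \<le> k" "k \<ge> 2"
  using two_tree_bounds[OF assms(1)] assms(2) by auto

lemma two_tree_new_edge:
  assumes "two_tree k T"
  shows "(a, Suc k) \<notin> insert (1, 2) T"
  using two_tree_bounds[OF assms] by force

lemma two_tree_snd_ge_3: "two_tree k T \<Longrightarrow> (a, b) \<in> T \<Longrightarrow> b \<ge> 3"
proof (induction arbitrary: a b rule: two_tree.induct)
  case (step k T i j)
  then show ?case using two_tree_bounds[OF step.hyps(1)] by force
qed simp

lemma root_edge_notin: "two_tree k T \<Longrightarrow> (1, 2) \<notin> T"
  using two_tree_snd_ge_3 by fastforce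

text \<open>
  The signs are chosen along the construction of the tree so that the relation $q_a + q_b + q_c = 0$ on
  a triple of rows becomes $p_{ik} - p_{jk} = p_{ij}$ on the triangle \<open>i, j, k\<close>. Off the tree the signs
  are nonzero default values.
\<close>

inductive signed_tree :: "nat \<Rightarrow> edge set \<Rightarrow> (edge \<Rightarrow> complex) \<Rightarrow> bool" where
  base: "signed_tree 2 {} (\<lambda>e. 1)"
| step: "signed_tree k T \<sigma> \<Longrightarrow> (i, j) \<in> insert (1, 2) T \<Longrightarrow>
    signed_tree (Suc k) (T \<union> {(i, Suc k), (j, Suc k)})
      (\<sigma>((i, Suc k) := - \<sigma> (i, j), (j, Suc k) := \<sigma> (i, j)))"

lemma signed_tree_imp_two_tree: "signed_tree k T \<sigma> \<Longrightarrow> two_tree k T"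
  by (induction rule: signed_tree.induct) (auto intro: two_tree.intros)

lemma two_tree_imp_signed_tree: "two_tree k T \<Longrightarrow> \<exists>\<sigma>. signed_tree k T \<sigma>"
  by (induction rule: two_tree.induct) (auto intro: signed_tree.intros)

lemma signed_tree_signs:
  assumes "signed_tree k T \<sigma>"
  shows "\<sigma> (1, 2) = 1" "\<sigma> e \<in> {-1, 1}"
proof -
  have "\<sigma> (1, 2) = 1 \<and> (\<forall>e. \<sigma> e \<in> {-1, 1})"
    using assms
  proof (induction rule: signed_tree.induct)
    case (step k T \<sigma> i j)
    have "Suc k \<noteq> 2"
      using two_tree_bounds[OF signed_tree_imp_two_tree[OF step.hyps(1)]] by auto
    moreover have "- \<sigma> (i, j) = -1 \<or> - \<sigma> (i, j) = 1" using step.IH by force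
    ultimately show ?case using step.IH by (auto simp: fun_upd_def)
  qed simp
  then show "\<sigma> (1, 2) = 1" "\<sigma> e \<in> {-1, 1}" by blast+
qed

section \<open>Columns of the matrix and their left kernel\<close>

text \<open>
  With the convention that the column of the edge $12$ is zero, the recursion for the columns is the
  same whether the new vertex is joined to $12$ or to another edge. It also covers the first triangle
  as an extension of the tree on two vertices, whose matrix has no rows, so that inductions start there.
\<close>

definition edge_column :: "nat \<Rightarrow> edge set \<Rightarrow> edge \<Rightarrow> nat \<Rightarrow> int" where
  "edge_column k T e r = (if e = (1, 2) then 0 else tree_matrix k T r e)"

lemma edge_column_old_row:
  assumes "two_tree k T" "(i, j) \<in> insert (1, 2) T" "r \<in> {1..3 * k - 6}"
    and "e \<in> insert (1, 2) T \<union> {(i, Suc k), (j, Suc k)}"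
  shows "edge_column (Suc k) (T \<union> {(i, Suc k), (j, Suc k)}) e r =
    edge_column k T (if e \<in> insert (1, 2) T then e else (i, j)) r"
proof -
  note b = two_tree_edge[OF assms(1,2)] two_tree_new_edge[OF assms(1)]
  have k3: "k \<ge> 3" and r: "r \<le> 3 * k - 6" using assms(3) by auto
  note H = tree_matrix_step[OF assms(1) k3 assms(2)]
  show ?thesis
  proof (cases "e \<in> insert (1, 2) T")
    case True
    then have "e \<noteq> (i, Suc k)" "e \<noteq> (j, Suc k)" using b(5) by auto
    then show ?thesis using True r by (simp add: edge_column_def H)
  next
    case False
    then have "e \<in> {(i, Suc k), (j, Suc k)}" "e \<noteq> (1, 2)" using assms(4) by auto
    then show ?thesis using False r by (simp add: edge_column_def H)
  qed
qed

lemma edge_column_new_rows: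
  assumes "two_tree k T" "(i, j) \<in> insert (1, 2) T"
    and "e \<in> insert (1, 2) T \<union> {(i, Suc k), (j, Suc k)}"
  defines "h \<equiv> edge_column (Suc k) (T \<union> {(i, Suc k), (j, Suc k)}) e"
  shows "h (3 * k - 5) = of_bool (e = (i, Suc k))"
    and "h (3 * k - 4) = of_bool (e = (j, Suc k))"
    and "h (3 * k - 3) = - of_bool (e \<notin> insert (1, 2) T)"
proof -
  note b = two_tree_edge[OF assms(1,2)] two_tree_new_edge[OF assms(1)]
  have ne: "(i, Suc k) \<noteq> (1, 2)" "(j, Suc k) \<noteq> (1, 2)"
    using b by auto
  have iff: "e \<in> {(i, Suc k), (j, Suc k)} \<longleftrightarrow> e \<notin> insert (1, 2) T"
    using assms(3) b(5)[of i] b(5)[of j] by auto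
  have "h (3 * k - 5) = of_bool (e = (i, Suc k)) \<and> h (3 * k - 4) = of_bool (e = (j, Suc k)) \<and>
    h (3 * k - 3) = - of_bool (e \<notin> insert (1, 2) T)"
  proof (cases "k = 2")
    case True
    have "T = {}" using card_two_tree[OF assms(1)] True by auto
    then show ?thesis using True assms(2,3)
      by (auto simp: h_def edge_column_def tree_matrix.simps[of 3] One_nat_def)
  next
    case False
    have k3: "k \<ge> 3" using False b(4) by simp
    have rows: "(3 * k - 5 \<le> 3 * k - 6) = False" "(3 * k - 4 \<le> 3 * k - 6) = False"
      "(3 * k - 3 \<le> 3 * k - 6) = False" "(3 * k - 4 = 3 * k - 5) = False"
      "(3 * k - 3 = 3 * k - 5) = False" "(3 * k - 3 = 3 * k - 4) = False" using k3 by auto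
    show ?thesis
      unfolding h_def edge_column_def tree_matrix_step[OF assms(1) k3 assms(2)] rows iff
      using ne by auto
  qed
  then show "h (3 * k - 5) = of_bool (e = (i, Suc k))" "h (3 * k - 4) = of_bool (e = (j, Suc k))"
    "h (3 * k - 3) = - of_bool (e \<notin> insert (1, 2) T)" by blast+
qed

lemma sum_rows_Suc:
  fixes f :: "nat \<Rightarrow> 'a :: comm_monoid_add"
  assumes "k \<ge> 2"
  shows "sum f {1..3 * Suc k - 6} =
    sum f {1..3 * k - 6} + f (3 * k - 5) + f (3 * k - 4) + f (3 * k - 3)"
proof -
  obtain m where m: "k = m + 2" using assms by (metis add.commute le_Suc_ex)
  have rows: "3 * Suc k - 6 = Suc (Suc (Suc (3 * m)))" "3 * k - 6 = 3 * m"
    "3 * k - 5 = Suc (3 * m)" "3 * k - 4 = Suc (Suc (3 * m))" "3 * k - 3 = Suc (Suc (Suc (3 * m)))"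
    using m by auto
  show ?thesis unfolding rows by simp
qed

lemma prod_rows_Suc:
  fixes f :: "nat \<Rightarrow> 'a :: comm_monoid_mult"
  assumes "k \<ge> 2"
  shows "prod f {1..3 * Suc k - 6} =
    prod f {1..3 * k - 6} * f (3 * k - 5) * f (3 * k - 4) * f (3 * k - 3)"
proof -
  obtain m where m: "k = m + 2" using assms by (metis add.commute le_Suc_ex)
  have rows: "3 * Suc k - 6 = Suc (Suc (Suc (3 * m)))" "3 * k - 6 = 3 * m"
    "3 * k - 5 = Suc (3 * m)" "3 * k - 4 = Suc (Suc (3 * m))" "3 * k - 3 = Suc (Suc (Suc (3 * m)))"
    using m by auto
  show ?thesis unfolding rows by simp
qed

lemma all_less_Suc_triple:
  assumes "k \<ge> 2"
  shows "(\<forall>m<Suc k - 2. P m) \<longleftrightarrow> (\<forall>m<k - 2. P m) \<and> P (k - 2)"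
  unfolding Suc_diff_le[OF assms] by (metis less_Suc_eq)

lemma last_triple:
  fixes k :: nat
  assumes "k \<ge> 2"
  shows "3 * (k - 2) + 1 = 3 * k - 5" "3 * (k - 2) + 2 = 3 * k - 4" "3 * (k - 2) + 3 = 3 * k - 3"
  using assms by auto

lemma column_pairing_step:
  fixes a :: "nat \<Rightarrow> int"
  assumes "two_tree k T" "(i, j) \<in> insert (1, 2) T"
    and "e \<in> insert (1, 2) T \<union> {(i, Suc k), (j, Suc k)}"
  shows "(\<Sum>r\<in>{1..3 * Suc k - 6}. a r * edge_column (Suc k) (T \<union> {(i, Suc k), (j, Suc k)}) e r) =
    (\<Sum>r\<in>{1..3 * k - 6}. a r * edge_column k T (if e \<in> insert (1, 2) T then e else (i, j)) r)
    + a (3 * k - 5) * of_bool (e = (i, Suc k)) + a (3 * k - 4) * of_bool (e = (j, Suc k))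
    - a (3 * k - 3) * of_bool (e \<notin> insert (1, 2) T)"
proof -
  have "(\<Sum>r\<in>{1..3 * k - 6}. a r * edge_column (Suc k) (T \<union> {(i, Suc k), (j, Suc k)}) e r) =
    (\<Sum>r\<in>{1..3 * k - 6}. a r * edge_column k T (if e \<in> insert (1, 2) T then e else (i, j)) r)"
    by (intro sum.cong refl) (simp only: edge_column_old_row[OF assms(1,2) _ assms(3)])
  then show ?thesis
    unfolding sum_rows_Suc[OF two_tree_edge(4)[OF assms(1,2)]] edge_column_new_rows[OF assms]
    by simp
qed

text \<open>
  Pairing with the columns $ik$ and $jk$ gives the pairing with the column $ij$, which is zero by
  induction, plus the difference of two entries in the new triple.
\<close>

lemma edge_column_orthogonal_iff:
  fixes a :: "nat \<Rightarrow> int"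
  assumes "two_tree k T"
  shows "(\<forall>e\<in>insert (1, 2) T. (\<Sum>r\<in>{1..3 * k - 6}. a r * edge_column k T e r) = 0) \<longleftrightarrow>
    (\<forall>m<k - 2. a (3 * m + 1) = a (3 * m + 3) \<and> a (3 * m + 2) = a (3 * m + 3))"
  using assms
proof (induction rule: two_tree.induct)
  case base
  then show ?case by (simp add: edge_column_def)
next
  case (step k T i j)
  note b = two_tree_edge[OF step.hyps] two_tree_new_edge[OF step.hyps(1)]
  let ?T' = "T \<union> {(i, Suc k), (j, Suc k)}"
  let ?s = "\<lambda>e. \<Sum>r\<in>{1..3 * k - 6}. a r * edge_column k T e r"
  let ?s' = "\<lambda>e. \<Sum>r\<in>{1..3 * Suc k - 6}. a r * edge_column (Suc k) ?T' e r"
  have old: "?s' e = ?s e" if "e \<in> insert (1, 2) T" for e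
    using column_pairing_step[OF step.hyps, of e a] that b(5)[of i] b(5)[of j] by auto
  have ik: "?s' (i, Suc k) = ?s (i, j) + a (3 * k - 5) - a (3 * k - 3)"
    using column_pairing_step[OF step.hyps, of "(i, Suc k)" a] b(2) b(5)[of i] by simp
  have jk: "?s' (j, Suc k) = ?s (i, j) + a (3 * k - 4) - a (3 * k - 3)"
    using column_pairing_step[OF step.hyps, of "(j, Suc k)" a] b(2) b(5)[of j] by simp
  have "(\<forall>e\<in>insert (1, 2) ?T'. ?s' e = 0) \<longleftrightarrow>
    (\<forall>e\<in>insert (1, 2) T. ?s' e = 0) \<and> ?s' (i, Suc k) = 0 \<and> ?s' (j, Suc k) = 0"
    by blast
  also have "\<dots> \<longleftrightarrow> (\<forall>e\<in>insert (1, 2) T. ?s e = 0) \<and>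
      a (3 * k - 5) = a (3 * k - 3) \<and> a (3 * k - 4) = a (3 * k - 3)"
  proof -
    have "(\<forall>e\<in>insert (1, 2) T. ?s' e = 0) \<longleftrightarrow> (\<forall>e\<in>insert (1, 2) T. ?s e = 0)"
      using old by (intro ball_cong) auto
    moreover have "(\<forall>e\<in>insert (1, 2) T. ?s e = 0) \<Longrightarrow> ?s (i, j) = 0"
      using step.hyps(2) by blast
    ultimately show ?thesis unfolding ik jk by linarith
  qed
  finally show ?case
    unfolding step.IH all_less_Suc_triple[OF b(4)] last_triple[OF b(4)] .
qed

lemma tree_matrix_eq_edge_column:
  "two_tree k T \<Longrightarrow> e \<in> T \<Longrightarrow> tree_matrix k T r e = edge_column k T e r"
  using root_edge_notin by (auto simp: edge_column_def)

lemma tree_matrix_orthogonal_iff: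
  fixes a :: "nat \<Rightarrow> int"
  assumes "two_tree k T"
  shows "(\<forall>e\<in>T. (\<Sum>r\<in>{1..3 * k - 6}. a r * tree_matrix k T r e) = 0) \<longleftrightarrow>
    (\<forall>m<k - 2. a (3 * m + 1) = a (3 * m + 3) \<and> a (3 * m + 2) = a (3 * m + 3))"
proof -
  have "(\<Sum>r\<in>{1..3 * k - 6}. a r * edge_column k T (1, 2) r) = 0"
    by (simp add: edge_column_def)
  then show ?thesis
    using edge_column_orthogonal_iff[OF assms, of a]
    by (simp add: tree_matrix_eq_edge_column[OF assms])
qed

section \<open>Monomials of the columns and the triangle relations\<close>

definition tree_monomial ::
  "nat \<Rightarrow> edge set \<Rightarrow> (edge \<Rightarrow> complex) \<Rightarrow> (nat \<Rightarrow> complex) \<Rightarrow> edge \<Rightarrow> complex" where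
  "tree_monomial k T \<sigma> q e = \<sigma> e * (\<Prod>r\<in>{1..3 * k - 6}. q r powi edge_column k T e r)"

lemma tree_monomial_root: "signed_tree k T \<sigma> \<Longrightarrow> tree_monomial k T \<sigma> q (1, 2) = 1"
  by (simp add: tree_monomial_def edge_column_def signed_tree_signs(1))

text \<open>
  The new columns are the column of $ij$ extended by $(1, 0, -1)$ and $(0, 1, -1)$, so the new monomials
  are the one of $ij$ times a quotient of two entries of the new triple.
\<close>

lemma tree_monomial_step:
  fixes \<sigma> :: "edge \<Rightarrow> complex" and q :: "nat \<Rightarrow> complex"
  assumes "signed_tree k T \<sigma>" "(i, j) \<in> insert (1, 2) T"
  defines "M' \<equiv> tree_monomial (Suc k) (T \<union> {(i, Suc k), (j, Suc k)})
    (\<sigma>((i, Suc k) := - \<sigma> (i, j), (j, Suc k) := \<sigma> (i, j))) q"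
  shows "e \<in> insert (1, 2) T \<Longrightarrow> M' e = tree_monomial k T \<sigma> q e"
    and "M' (i, Suc k) = - tree_monomial k T \<sigma> q (i, j) * q (3 * k - 5) / q (3 * k - 3)"
    and "M' (j, Suc k) = tree_monomial k T \<sigma> q (i, j) * q (3 * k - 4) / q (3 * k - 3)"
proof -
  note t = signed_tree_imp_two_tree[OF assms(1)]
  note b = two_tree_edge[OF t assms(2)] two_tree_new_edge[OF t]
  let ?T' = "T \<union> {(i, Suc k), (j, Suc k)}"
  have M': "M' e = (\<sigma>((i, Suc k) := - \<sigma> (i, j), (j, Suc k) := \<sigma> (i, j))) e *
      (\<Prod>r\<in>{1..3 * k - 6}. q r powi edge_column k T (if e \<in> insert (1, 2) T then e else (i, j)) r) *
      q (3 * k - 5) powi of_bool (e = (i, Suc k)) * q (3 * k - 4) powi of_bool (e = (j, Suc k)) *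
      q (3 * k - 3) powi (- of_bool (e \<notin> insert (1, 2) T))"
    if e: "e \<in> insert (1, 2) T \<union> {(i, Suc k), (j, Suc k)}" for e
  proof -
    have "(\<Prod>r\<in>{1..3 * k - 6}. q r powi edge_column (Suc k) ?T' e r) = (\<Prod>r\<in>{1..3 * k - 6}.
        q r powi edge_column k T (if e \<in> insert (1, 2) T then e else (i, j)) r)"
      by (intro prod.cong refl) (simp only: edge_column_old_row[OF t assms(2) _ e])
    then show ?thesis
      unfolding M'_def tree_monomial_def prod_rows_Suc[OF b(4)]
        edge_column_new_rows[OF t assms(2) e] by (simp only: mult.assoc)
  qed
  show "M' e = tree_monomial k T \<sigma> q e" if e: "e \<in> insert (1, 2) T"
  proof -
    have ne: "e \<noteq> (i, Suc k)" "e \<noteq> (j, Suc k)" using e b(5) by auto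
    have "M' e = \<sigma> e * (\<Prod>r\<in>{1..3 * k - 6}. q r powi edge_column k T e r)"
      using M'[OF UnI1[OF e]] e ne by (simp del: insert_iff)
    then show ?thesis by (simp only: tree_monomial_def)
  qed
  have ne: "(i, Suc k) \<noteq> (j, Suc k)" "(j, Suc k) \<noteq> (i, Suc k)" using b(2) by auto
  show "M' (i, Suc k) = - tree_monomial k T \<sigma> q (i, j) * q (3 * k - 5) / q (3 * k - 3)"
    using M'[of "(i, Suc k)"] ne b(5)[of i]
    by (simp add: tree_monomial_def power_int_minus divide_inverse)
  show "M' (j, Suc k) = tree_monomial k T \<sigma> q (i, j) * q (3 * k - 4) / q (3 * k - 3)"
    using M'[of "(j, Suc k)"] ne b(5)[of j]
    by (simp add: tree_monomial_def power_int_minus divide_inverse)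
qed

definition edge_diff :: "(nat \<Rightarrow> complex) \<Rightarrow> edge \<Rightarrow> complex" where
  "edge_diff y e = y (snd e) - y (fst e)"

definition triple_sums_zero :: "nat \<Rightarrow> (nat \<Rightarrow> complex) \<Rightarrow> bool" where
  "triple_sums_zero k q \<longleftrightarrow> (\<forall>m<k - 2. q (3 * m + 1) + q (3 * m + 2) + q (3 * m + 3) = 0)"

lemma triple_sums_zero_Suc:
  assumes "k \<ge> 2"
  shows "triple_sums_zero (Suc k) q \<longleftrightarrow>
    triple_sums_zero k q \<and> q (3 * k - 5) + q (3 * k - 4) + q (3 * k - 3) = 0"
  unfolding triple_sums_zero_def all_less_Suc_triple[OF assms] last_triple[OF assms] ..

lemma triple_sums_zero_cong:
  assumes "\<And>r. r \<in> {1..3 * k - 6} \<Longrightarrow> q r = q' r"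
  shows "triple_sums_zero k q \<longleftrightarrow> triple_sums_zero k q'"
proof -
  have "q (3 * m + 1) = q' (3 * m + 1) \<and> q (3 * m + 2) = q' (3 * m + 2) \<and>
      q (3 * m + 3) = q' (3 * m + 3)" if "m < k - 2" for m
    using that by (intro conjI assms) auto
  then show ?thesis by (simp add: triple_sums_zero_def)
qed

lemma tree_monomial_cong:
  assumes "\<And>r. r \<in> {1..3 * k - 6} \<Longrightarrow> q r = q' r"
  shows "tree_monomial k T \<sigma> q e = tree_monomial k T \<sigma> q' e"
  unfolding tree_monomial_def using assms by simp

lemma tree_monomial_nonzero:
  assumes "signed_tree k T \<sigma>" "\<And>r. r \<in> {1..3 * k - 6} \<Longrightarrow> q r \<noteq> 0"
  shows "tree_monomial k T \<sigma> q e \<noteq> 0"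
proof -
  have "\<sigma> e \<noteq> 0" using signed_tree_signs(2)[OF assms(1), of e] by auto
  then show ?thesis using assms(2) by (simp add: tree_monomial_def)
qed

lemma new_rows:
  assumes "k \<ge> 2"
  shows "3 * k - 5 \<in> {1..3 * Suc k - 6}" "3 * k - 4 \<in> {1..3 * Suc k - 6}"
    "3 * k - 3 \<in> {1..3 * Suc k - 6}" "r \<in> {1..3 * k - 6} \<Longrightarrow> r \<in> {1..3 * Suc k - 6}"
  using assms by auto

lemma rows_Suc_cases:
  assumes "r \<in> {1..3 * Suc k - 6}"
  obtains "r \<in> {1..3 * k - 6}" | "r = 3 * k - 5" | "r = 3 * k - 4" | "r = 3 * k - 3"
proof -
  have "r \<le> 3 * k - 6 \<or> r = 3 * k - 5 \<or> r = 3 * k - 4 \<or> r = 3 * k - 3" "r \<ge> 1"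
    using assms by auto
  then show ?thesis using that by auto
qed

text \<open>
  If the new triple \<open>(a, b, c)\<close> sums to zero, then the equation for the edge $jk$ follows from those for
  $ij$ and $ik$: with $p_{ik} = -p_{ij} a / c$ one gets
  $p_{ik} - p_{ij} = -p_{ij} (a + c) / c = p_{ij} b / c$. So one equation determines the position of the
  new vertex.
\<close>

lemma edge_diff_monomial_step:
  fixes q y :: "nat \<Rightarrow> complex"
  assumes "signed_tree k T \<sigma>" "(i, j) \<in> insert (1, 2) T"
    and "q (3 * k - 3) \<noteq> 0" "q (3 * k - 5) + q (3 * k - 4) + q (3 * k - 3) = 0"
  defines "M' \<equiv> tree_monomial (Suc k) (T \<union> {(i, Suc k), (j, Suc k)})
    (\<sigma>((i, Suc k) := - \<sigma> (i, j), (j, Suc k) := \<sigma> (i, j))) q"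
  shows "(\<forall>e\<in>insert (1, 2) (T \<union> {(i, Suc k), (j, Suc k)}). edge_diff y e = M' e) \<longleftrightarrow>
    (\<forall>e\<in>insert (1, 2) T. edge_diff y e = tree_monomial k T \<sigma> q e) \<and>
    y (Suc k) = y i - tree_monomial k T \<sigma> q (i, j) * q (3 * k - 5) / q (3 * k - 3)"
    (is "?L \<longleftrightarrow> ?R1 \<and> ?R2")
proof -
  note M' = tree_monomial_step[OF assms(1,2), where q = q, folded M'_def]
  have "?L \<longleftrightarrow> (\<forall>e\<in>insert (1, 2) T. edge_diff y e = M' e) \<and>
    edge_diff y (i, Suc k) = M' (i, Suc k) \<and> edge_diff y (j, Suc k) = M' (j, Suc k)"
    by blast
  also have "(\<forall>e\<in>insert (1, 2) T. edge_diff y e = M' e) \<longleftrightarrow> ?R1"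
    by (intro ball_cong refl) (simp only: M'(1))
  also have "edge_diff y (i, Suc k) = M' (i, Suc k) \<longleftrightarrow> ?R2"
    unfolding M'(2) by (auto simp: edge_diff_def algebra_simps)
  finally have L: "?L \<longleftrightarrow> ?R1 \<and> ?R2 \<and> edge_diff y (j, Suc k) = M' (j, Suc k)" .
  have "edge_diff y (j, Suc k) = M' (j, Suc k)" if R: ?R1 ?R2
  proof -
    let ?M = "tree_monomial k T \<sigma> q (i, j)"
    have ij: "y j = y i + ?M" using bspec[OF R(1) assms(2)] by (simp add: edge_diff_def algebra_simps)
    have b: "q (3 * k - 4) = - q (3 * k - 5) - q (3 * k - 3)" using assms(4) by algebra
    show ?thesis
      unfolding M'(3) edge_diff_def fst_conv snd_conv R(2) ij b
      using assms(3) by (simp add: field_simps)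
  qed
  then show ?thesis using L by blast
qed

lemma edge_diff_cong:
  assumes "two_tree k T" "\<And>v. v \<le> k \<Longrightarrow> y v = y' v" "e \<in> insert (1, 2) T"
  shows "edge_diff y e = edge_diff y' e"
proof -
  obtain i j where "e = (i, j)" by (cases e)
  then show ?thesis using two_tree_edge[OF assms(1), of i j] assms(2,3) by (simp add: edge_diff_def)
qed

text \<open>
  Points of the linear space of all \<open>q\<close> with zero triple sums give configurations: the vertices are
  placed one after the other.
\<close>

lemma tree_monomial_imp_edge_diff:
  assumes "signed_tree k T \<sigma>" "\<And>r. r \<in> {1..3 * k - 6} \<Longrightarrow> q r \<noteq> 0" "triple_sums_zero k q"
  shows "\<exists>y. y 1 = 0 \<and> y 2 = 1 \<and> (\<forall>e\<in>insert (1, 2) T. edge_diff y e = tree_monomial k T \<sigma> q e)"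
  using assms
proof (induction rule: signed_tree.induct)
  case base
  show ?case
    by (rule exI[of _ "\<lambda>v. of_bool (v = 2)"])
      (simp add: edge_diff_def tree_monomial_def edge_column_def)
next
  case (step k T \<sigma> i j)
  note t = signed_tree_imp_two_tree[OF step.hyps(1)]
  note b = two_tree_edge[OF t step.hyps(2)]
  have sums: "triple_sums_zero k q" "q (3 * k - 5) + q (3 * k - 4) + q (3 * k - 3) = 0"
    using step.prems(2) unfolding triple_sums_zero_Suc[OF b(4)] by auto
  have "q r \<noteq> 0" if "r \<in> {1..3 * k - 6}" for r
    by (rule step.prems(1)[OF new_rows(4)[OF b(4) that]])
  then obtain y where y: "y 1 = 0" "y 2 = 1"
      "\<forall>e\<in>insert (1, 2) T. edge_diff y e = tree_monomial k T \<sigma> q e"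
    using step.IH sums(1) by blast
  define y' where "y' = y(Suc k := y i - tree_monomial k T \<sigma> q (i, j) * q (3 * k - 5) / q (3 * k - 3))"
  have y'y: "y' v = y v" if "v \<le> k" for v using that by (simp add: y'_def)
  have "\<forall>e\<in>insert (1, 2) T. edge_diff y' e = tree_monomial k T \<sigma> q e"
    using y(3) edge_diff_cong[OF t y'y] by auto
  moreover have "y' (Suc k) = y' i - tree_monomial k T \<sigma> q (i, j) * q (3 * k - 5) / q (3 * k - 3)"
    using b by (simp add: y'_def)
  moreover have "y' 1 = 0" "y' 2 = 1" using y'y y b by auto
  ultimately show ?case
    using edge_diff_monomial_step[OF step.hyps step.prems(1)[OF new_rows(3)[OF b(4)]] sums(2), of y']
    by blast
qed

text \<open>
  Conversely, the triangle with sides $p_{ij}$, $p_{ik}$, $p_{jk}$ determines its triple up to a factor,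
  which is normalised by setting the last entry to one.
\<close>

lemma edge_diff_imp_tree_monomial:
  assumes "signed_tree k T \<sigma>" "y 1 = 0" "y 2 = 1" "\<And>e. e \<in> T \<Longrightarrow> edge_diff y e \<noteq> 0"
  shows "\<exists>q. (\<forall>r\<in>{1..3 * k - 6}. q r \<noteq> 0) \<and> triple_sums_zero k q \<and>
    (\<forall>e\<in>insert (1, 2) T. edge_diff y e = tree_monomial k T \<sigma> q e)"
  using assms
proof (induction rule: signed_tree.induct)
  case base
  then show ?case
    by (auto simp: edge_diff_def tree_monomial_def edge_column_def triple_sums_zero_def)
next
  case (step k T \<sigma> i j)
  note t = signed_tree_imp_two_tree[OF step.hyps(1)]
  note b = two_tree_edge[OF t step.hyps(2)]
  obtain q where q: "\<forall>r\<in>{1..3 * k - 6}. q r \<noteq> 0" "triple_sums_zero k q"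
      "\<forall>e\<in>insert (1, 2) T. edge_diff y e = tree_monomial k T \<sigma> q e"
    using step.IH step.prems by blast
  have "edge_diff y (1, 2) \<noteq> 0" using step.prems by (simp add: edge_diff_def)
  then have ij: "edge_diff y (i, j) \<noteq> 0" using step.hyps(2) step.prems(3)[of "(i, j)"] by auto
  have new: "edge_diff y (i, Suc k) \<noteq> 0" "edge_diff y (j, Suc k) \<noteq> 0"
    using step.prems(3) by auto
  define q' where "q' = q(3 * k - 5 := - edge_diff y (i, Suc k) / edge_diff y (i, j),
    3 * k - 4 := edge_diff y (j, Suc k) / edge_diff y (i, j), 3 * k - 3 := 1)"
  have q'q: "q' r = q r" if "r \<in> {1..3 * k - 6}" for r
    using that by (auto simp: q'_def)
  have ne: "3 * k - 5 \<noteq> 3 * k - 4" "3 * k - 5 \<noteq> 3 * k - 3" "3 * k - 4 \<noteq> 3 * k - 3"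
    using b(4) by auto
  have q'_new: "q' (3 * k - 5) = - edge_diff y (i, Suc k) / edge_diff y (i, j)"
    "q' (3 * k - 4) = edge_diff y (j, Suc k) / edge_diff y (i, j)" "q' (3 * k - 3) = 1"
    unfolding q'_def using ne by simp_all
  have nz: "\<forall>r\<in>{1..3 * Suc k - 6}. q' r \<noteq> 0"
  proof
    fix r assume "r \<in> {1..3 * Suc k - 6}"
    then show "q' r \<noteq> 0"
      by (cases rule: rows_Suc_cases) (use q(1) q'q q'_new new ij in simp_all)
  qed
  have sum: "q' (3 * k - 5) + q' (3 * k - 4) + q' (3 * k - 3) = 0"
  proof -
    have "edge_diff y (j, Suc k) = edge_diff y (i, Suc k) - edge_diff y (i, j)"
      by (simp add: edge_diff_def)
    then show ?thesis unfolding q'_new using ij by (simp add: diff_divide_distrib)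
  qed
  have "triple_sums_zero (Suc k) q'"
    unfolding triple_sums_zero_Suc[OF b(4)] using sum q(2) triple_sums_zero_cong[of k q' q] q'q by blast
  moreover have M: "tree_monomial k T \<sigma> q' e = tree_monomial k T \<sigma> q e" for e
    by (rule tree_monomial_cong) (rule q'q)
  have "tree_monomial k T \<sigma> q (i, j) = edge_diff y (i, j)"
    using q(3) step.hyps(2) by (metis (no_types))
  then have "y (Suc k) = y i - tree_monomial k T \<sigma> q' (i, j) * q' (3 * k - 5) / q' (3 * k - 3)"
    unfolding M q'_new using ij by (simp add: edge_diff_def)
  then have "\<forall>e\<in>insert (1, 2) (T \<union> {(i, Suc k), (j, Suc k)}). edge_diff y e =
      tree_monomial (Suc k) (T \<union> {(i, Suc k), (j, Suc k)})
        (\<sigma>((i, Suc k) := - \<sigma> (i, j), (j, Suc k) := \<sigma> (i, j))) q' e"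
    using edge_diff_monomial_step[OF step.hyps _ sum, of y] q(3) q'_new(3) by (simp only: M) simp
  ultimately show ?case using nz by blast
qed

section \<open>Elimination of the last vertex\<close>

text \<open>The vector $H_T s$.\<close>

definition tree_image :: "nat \<Rightarrow> edge set \<Rightarrow> (edge \<Rightarrow> complex) \<Rightarrow> nat \<Rightarrow> complex" where
  "tree_image k T s r = (\<Sum>e\<in>T. of_int (edge_column k T e r) * s e)"

text \<open>
  The weights after elimination of the vertex \<open>Suc k\<close>. If it was joined to the edge $12$, the changed
  value lies off the tree and has no effect, in accordance with $\log p_{12} = 0$.
\<close>

definition contract_weights ::
  "nat \<Rightarrow> nat \<Rightarrow> nat \<Rightarrow> (edge \<Rightarrow> complex) \<Rightarrow> edge \<Rightarrow> complex" where
  "contract_weights k i j s = s((i, j) := s (i, j) + s (i, Suc k) + s (j, Suc k))"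

lemma sum_new_edges:
  fixes f :: "edge \<Rightarrow> complex"
  assumes "two_tree k T" "(i, j) \<in> insert (1, 2) T"
  shows "sum f (T \<union> {(i, Suc k), (j, Suc k)}) = sum f T + (f (i, Suc k) + f (j, Suc k))"
proof -
  have "finite T" "(i, Suc k) \<notin> T" "(j, Suc k) \<notin> T" "i \<noteq> j"
    using card_two_tree[OF assms(1)] two_tree_new_edge[OF assms(1)] two_tree_edge[OF assms] by auto
  then show ?thesis by (subst sum.union_disjoint) auto
qed

lemma sum_contract_weights:
  fixes g :: "edge \<Rightarrow> complex"
  assumes "two_tree k T" "(i, j) \<in> insert (1, 2) T" "g (1, 2) = 0"
  shows "(\<Sum>e\<in>T. g e * contract_weights k i j s e) =
    (\<Sum>e\<in>T. g e * s e) + g (i, j) * (s (i, Suc k) + s (j, Suc k))"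
proof (cases "(i, j) \<in> T")
  case True
  have fin: "finite T" using card_two_tree[OF assms(1)] by simp
  have "(\<Sum>e\<in>T. g e * contract_weights k i j s e) =
    (\<Sum>e\<in>T. g e * s e + (if e = (i, j) then g e * (s (i, Suc k) + s (j, Suc k)) else 0))"
    by (intro sum.cong) (auto simp: contract_weights_def algebra_simps)
  then show ?thesis using True fin by (simp add: sum.distrib)
next
  case False
  then have "(i, j) = (1, 2)" using assms(2) by auto
  moreover have "(\<Sum>e\<in>T. g e * contract_weights k i j s e) = (\<Sum>e\<in>T. g e * s e)"
    using False by (intro sum.cong) (auto simp: contract_weights_def)
  ultimately show ?thesis using assms(3) by simp
qed

lemma tree_image_step:
  fixes s :: "edge \<Rightarrow> complex"
  assumes "two_tree k T" "(i, j) \<in> insert (1, 2) T"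
  defines "I' \<equiv> tree_image (Suc k) (T \<union> {(i, Suc k), (j, Suc k)}) s"
  shows "r \<in> {1..3 * k - 6} \<Longrightarrow> I' r = tree_image k T (contract_weights k i j s) r"
    and "I' (3 * k - 5) = s (i, Suc k)"
    and "I' (3 * k - 4) = s (j, Suc k)"
    and "I' (3 * k - 3) = - (s (i, Suc k) + s (j, Suc k))"
proof -
  note b = two_tree_edge[OF assms(1,2)] two_tree_new_edge[OF assms(1)]
  let ?T' = "T \<union> {(i, Suc k), (j, Suc k)}"
  let ?h = "\<lambda>e r. of_int (edge_column (Suc k) ?T' e r) :: complex"
  have I': "I' r = (\<Sum>e\<in>T. ?h e r * s e) +
      (?h (i, Suc k) r * s (i, Suc k) + ?h (j, Suc k) r * s (j, Suc k))" for r
    unfolding I'_def tree_image_def by (rule sum_new_edges[OF assms(1,2)])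
  have notin: "(i, Suc k) \<notin> T" "(j, Suc k) \<notin> T" "(i, Suc k) \<noteq> (1, 2)" "(j, Suc k) \<noteq> (1, 2)"
    "(i, Suc k) \<noteq> (j, Suc k)" "(j, Suc k) \<noteq> (i, Suc k)"
    using b by auto
  show "I' r = tree_image k T (contract_weights k i j s) r" if r: "r \<in> {1..3 * k - 6}"
  proof -
    have "(\<Sum>e\<in>T. ?h e r * s e) = (\<Sum>e\<in>T. of_int (edge_column k T e r) * s e)"
      by (intro sum.cong refl) (simp add: edge_column_old_row[OF assms(1,2) r])
    moreover have "?h (i, Suc k) r = of_int (edge_column k T (i, j) r)"
      "?h (j, Suc k) r = of_int (edge_column k T (i, j) r)"
      using notin b(4) by (simp_all add: edge_column_old_row[OF assms(1,2) r])
    ultimately show ?thesis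
      unfolding I' tree_image_def
      using sum_contract_weights[OF assms(1,2), of "\<lambda>e. of_int (edge_column k T e r)" s]
      by (simp only: edge_column_def if_True of_int_0 refl add.assoc distrib_left)
  qed
  note new = edge_column_new_rows[OF assms(1,2)]
  have old: "e \<noteq> (i, Suc k)" "e \<noteq> (j, Suc k)" if "e \<in> T" for e using that notin by auto
  have "(\<Sum>e\<in>T. ?h e (3 * k - 5) * s e) = 0" "(\<Sum>e\<in>T. ?h e (3 * k - 4) * s e) = 0"
    "(\<Sum>e\<in>T. ?h e (3 * k - 3) * s e) = 0"
    using old by (auto simp: new intro!: sum.neutral)
  then show "I' (3 * k - 5) = s (i, Suc k)" "I' (3 * k - 4) = s (j, Suc k)"
    "I' (3 * k - 3) = - (s (i, Suc k) + s (j, Suc k))"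
    unfolding I' using notin by (simp_all add: new)
qed

text \<open>
  Elimination adds weights, so it preserves positivity; the lower rows are two weights and minus their
  sum.
\<close>

lemma tree_image_Re_pos_nonzero:
  assumes "two_tree k T" "\<And>e. e \<in> T \<Longrightarrow> Re (s e) > 0" "r \<in> {1..3 * k - 6}"
  shows "tree_image k T s r \<noteq> 0"
  using assms
proof (induction arbitrary: s r rule: two_tree.induct)
  case base
  then show ?case by simp
next
  case (step k T i j)
  have new: "Re (s (i, Suc k)) > 0" "Re (s (j, Suc k)) > 0" using step.prems(1) by auto
  have "Re (contract_weights k i j s e) > 0" if "e \<in> T" for e
    using step.prems(1)[of e] that new by (auto simp: contract_weights_def)
  note IH = step.IH[OF this]
  from step.prems(2) show ?case
  proof (cases rule: rows_Suc_cases)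
    case 1
    then show ?thesis using IH tree_image_step(1)[OF step.hyps] by simp
  next
    case 2
    then show ?thesis using new tree_image_step(2)[OF step.hyps] by auto
  next
    case 3
    then show ?thesis using new tree_image_step(3)[OF step.hyps] by auto
  next
    case 4
    have "Re (- (s (i, Suc k) + s (j, Suc k))) < 0" using new by simp
    then show ?thesis unfolding 4 tree_image_step(4)[OF step.hyps] by (metis less_irrefl zero_complex.sel(1))
  qed
qed

lemma triple_sums_zero_tree_image:
  assumes "two_tree k T"
  shows "triple_sums_zero k (tree_image k T s)"
  using assms
proof (induction arbitrary: s rule: two_tree.induct)
  case base
  then show ?case by (simp add: triple_sums_zero_def)
next
  case (step k T i j)
  note b = two_tree_edge[OF step.hyps]
  show ?case
    unfolding triple_sums_zero_Suc[OF b(4)] tree_image_step(2-4)[OF step.hyps]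
    using step.IH[of "contract_weights k i j s"]
      triple_sums_zero_cong[of k "tree_image (Suc k) (T \<union> {(i, Suc k), (j, Suc k)}) s",
        OF tree_image_step(1)[OF step.hyps]]
    by simp
qed

text \<open>The partial derivative of the potential with respect to the position of the vertex \<open>v\<close>.\<close>

definition vertex_force :: "edge set \<Rightarrow> (edge \<Rightarrow> complex) \<Rightarrow> (nat \<Rightarrow> complex) \<Rightarrow> nat \<Rightarrow> complex" where
  "vertex_force T s y v =
     (\<Sum>e\<in>T. (of_bool (snd e = v) - of_bool (fst e = v)) / edge_diff y e * s e)"

text \<open>
  Write \<open>a\<close>, \<open>c\<close> for the weights of the two new edges and $w = (a + c) / p_{ij}$. The equation at the new
  vertex says $a / p_{ik} = w$ and $c / p_{jk} = -w$. In the equations at $i$ and $j$, these two terms act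
  like an additional weight $a + c$ on the edge $ij$, which is the contracted weight.
\<close>

lemma vertex_force_iff_tree_monomial:
  assumes "signed_tree k T \<sigma>" "y 1 = 0" "y 2 = 1" "\<And>e. e \<in> T \<Longrightarrow> edge_diff y e \<noteq> 0"
    and "\<And>r. r \<in> {1..3 * k - 6} \<Longrightarrow> tree_image k T s r \<noteq> 0"
  shows "(\<forall>v\<in>{3..k}. vertex_force T s y v = 0) \<longleftrightarrow>
    (\<forall>e\<in>insert (1, 2) T. edge_diff y e = tree_monomial k T \<sigma> (tree_image k T s) e)"
  using assms
proof (induction arbitrary: s rule: signed_tree.induct)
  case base
  then show ?case by (simp add: edge_diff_def tree_monomial_def edge_column_def)
next
  case (step k T \<sigma> i j)
  note t = signed_tree_imp_two_tree[OF step.hyps(1)]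
  note b = two_tree_edge[OF t step.hyps(2)] two_tree_new_edge[OF t]
  note I = tree_image_step[OF t step.hyps(2), where s = s]
  let ?T' = "T \<union> {(i, Suc k), (j, Suc k)}"
  let ?q = "tree_image (Suc k) ?T' s"
  let ?s = "contract_weights k i j s"
  define a where "a = s (i, Suc k)"
  define c where "c = s (j, Suc k)"
  have ac: "a + c \<noteq> 0"
    using step.prems(4)[OF new_rows(3)[OF b(4)]] unfolding I(4) a_def c_def neg_equal_0_iff_equal .
  have "edge_diff y (1, 2) \<noteq> 0" using step.prems by (simp add: edge_diff_def)
  then have ij: "edge_diff y (i, j) \<noteq> 0" using step.hyps(2) step.prems(3)[of "(i, j)"] by auto
  have new: "edge_diff y (i, Suc k) \<noteq> 0" "edge_diff y (j, Suc k) \<noteq> 0"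
    using step.prems(3) by auto
  have IH: "(\<forall>v\<in>{3..k}. vertex_force T ?s y v = 0) \<longleftrightarrow>
    (\<forall>e\<in>insert (1, 2) T. edge_diff y e = tree_monomial k T \<sigma> ?q e)"
  proof -
    have "tree_image k T ?s r \<noteq> 0" if "r \<in> {1..3 * k - 6}" for r
      using step.prems(4)[OF new_rows(4)[OF b(4) that]] I(1)[OF that] by simp
    then have "(\<forall>v\<in>{3..k}. vertex_force T ?s y v = 0) \<longleftrightarrow>
      (\<forall>e\<in>insert (1, 2) T. edge_diff y e = tree_monomial k T \<sigma> (tree_image k T ?s) e)"
      using step.IH step.prems(1-3) by blast
    moreover have "tree_monomial k T \<sigma> (tree_image k T ?s) e = tree_monomial k T \<sigma> ?q e" for e
      by (rule tree_monomial_cong) (simp only: I(1))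
    ultimately show ?thesis by simp
  qed
  have force: "vertex_force ?T' s y v = vertex_force T s y v +
      ((of_bool (Suc k = v) - of_bool (i = v)) / edge_diff y (i, Suc k) * a
      + (of_bool (Suc k = v) - of_bool (j = v)) / edge_diff y (j, Suc k) * c)" for v
    unfolding vertex_force_def sum_new_edges[OF t step.hyps(2)] by (simp add: a_def c_def)
  have "vertex_force T s y (Suc k) = 0"
    unfolding vertex_force_def
  proof (rule sum.neutral, rule ballI)
    fix e assume "e \<in> T"
    then have "fst e \<le> k" "snd e \<le> k"
      using two_tree_edge[OF t, of "fst e" "snd e"] by auto
    then show "(of_bool (snd e = Suc k) - of_bool (fst e = Suc k)) / edge_diff y e * s e = 0" by auto
  qed
  then have last: "vertex_force ?T' s y (Suc k) = 0 \<longleftrightarrow>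
      a / edge_diff y (i, Suc k) + c / edge_diff y (j, Suc k) = 0"
    unfolding force using b by auto
  have split: "edge_diff y (j, Suc k) = edge_diff y (i, Suc k) - edge_diff y (i, j)"
    by (simp add: edge_diff_def)
  have balance: "a / edge_diff y (i, Suc k) + c / edge_diff y (j, Suc k) = 0 \<longleftrightarrow>
      (a + c) * edge_diff y (i, Suc k) = a * edge_diff y (i, j)"
    using new unfolding split by (simp add: field_simps)
  have others: "vertex_force ?T' s y v = vertex_force T ?s y v"
    if v: "v \<in> {3..k}" and bal: "(a + c) * edge_diff y (i, Suc k) = a * edge_diff y (i, j)" for v
  proof -
    have root: "(of_bool (snd (1::nat, 2::nat) = v) - of_bool (fst (1::nat, 2::nat) = v)) / edge_diff y (1, 2) = 0"
      using v by simp
    have w: "a / edge_diff y (i, Suc k) = (a + c) / edge_diff y (i, j)"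
      using bal ij new by (simp add: field_simps)
    have w': "c / edge_diff y (j, Suc k) = - ((a + c) / edge_diff y (i, j))"
      using balance bal w by (simp add: add_eq_0_iff)
    have "Suc k \<noteq> v" using v by auto
    then have "vertex_force ?T' s y v = vertex_force T s y v -
        (of_bool (i = v) * (a / edge_diff y (i, Suc k)) + of_bool (j = v) * (c / edge_diff y (j, Suc k)))"
      unfolding force by simp
    also have "\<dots> = vertex_force T s y v + (of_bool (j = v) - of_bool (i = v)) / edge_diff y (i, j) * (a + c)"
      unfolding w w' by (simp add: algebra_simps diff_divide_distrib)
    also have "\<dots> = vertex_force T ?s y v"
      unfolding vertex_force_def
      using sum_contract_weights[of k T i j
        "\<lambda>e. (of_bool (snd e = v) - of_bool (fst e = v)) / edge_diff y e" s, OF t step.hyps(2) root]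
      by (simp add: a_def c_def)
    finally show ?thesis .
  qed
  have "(\<forall>v\<in>{3..Suc k}. vertex_force ?T' s y v = 0) \<longleftrightarrow>
      (\<forall>v\<in>{3..k}. vertex_force ?T' s y v = 0) \<and> vertex_force ?T' s y (Suc k) = 0"
    using b(4) by (auto simp: le_Suc_eq)
  also have "\<dots> \<longleftrightarrow> (\<forall>v\<in>{3..k}. vertex_force T ?s y v = 0) \<and>
      (a + c) * edge_diff y (i, Suc k) = a * edge_diff y (i, j)"
    unfolding last balance using others by auto
  also have "\<dots> \<longleftrightarrow> (\<forall>e\<in>insert (1, 2) T. edge_diff y e = tree_monomial k T \<sigma> ?q e) \<and>
      (a + c) * edge_diff y (i, Suc k) = a * edge_diff y (i, j)"
    unfolding IH ..
  also have "\<dots> \<longleftrightarrow> (\<forall>e\<in>insert (1, 2) T. edge_diff y e = tree_monomial k T \<sigma> ?q e) \<and>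
      y (Suc k) = y i - tree_monomial k T \<sigma> ?q (i, j) * ?q (3 * k - 5) / ?q (3 * k - 3)"
  proof (intro conj_cong refl)
    assume "\<forall>e\<in>insert (1, 2) T. edge_diff y e = tree_monomial k T \<sigma> ?q e"
    then have M: "tree_monomial k T \<sigma> ?q (i, j) = edge_diff y (i, j)"
      using step.hyps(2) by (metis (no_types))
    have "y (Suc k) = y i - edge_diff y (i, j) * a / (- (a + c)) \<longleftrightarrow>
        edge_diff y (i, Suc k) = a * edge_diff y (i, j) / (a + c)"
      unfolding divide_minus_right mult.commute[of _ a]
      by (simp add: edge_diff_def[of y "(i, Suc k)"] diff_eq_eq add.commute)
    also have "\<dots> \<longleftrightarrow> (a + c) * edge_diff y (i, Suc k) = a * edge_diff y (i, j)"
      using ac by (simp add: field_simps)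
    finally show "((a + c) * edge_diff y (i, Suc k) = a * edge_diff y (i, j)) \<longleftrightarrow>
      y (Suc k) = y i - tree_monomial k T \<sigma> ?q (i, j) * ?q (3 * k - 5) / ?q (3 * k - 3)"
      unfolding M I(2,4) a_def[symmetric] c_def[symmetric] by simp
  qed
  also have "\<dots> \<longleftrightarrow> (\<forall>e\<in>insert (1, 2) ?T'. edge_diff y e = tree_monomial (Suc k) ?T'
        (\<sigma>((i, Suc k) := - \<sigma> (i, j), (j, Suc k) := \<sigma> (i, j))) ?q e)"
  proof (rule edge_diff_monomial_step[OF step.hyps, symmetric])
    show "?q (3 * k - 3) \<noteq> 0" by (rule step.prems(4)[OF new_rows(3)[OF b(4)]])
    show "?q (3 * k - 5) + ?q (3 * k - 4) + ?q (3 * k - 3) = 0" unfolding I(2-4) by simp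
  qed
  finally show ?case .
qed

section \<open>Derivatives of the potential\<close>

lemma log_branch_exists:
  assumes "z \<noteq> 0"
  shows "\<exists>U l. log_branch U l \<and> z \<in> U"
proof -
  \<comment> \<open>In this disc, the real part of \<open>w / z\<close> is positive.\<close>
  let ?U = "ball z (norm z)"
  let ?l = "\<lambda>w. Ln (w / z) + Ln z"
  have notin: "w / z \<notin> \<real>\<^sub>\<le>\<^sub>0 \<and> w \<noteq> 0" if "w \<in> ?U" for w
  proof -
    have "norm (1 - w / z) < 1"
    proof -
      have "norm (z * (1 - w / z)) < norm z"
        using that assms by (simp add: dist_norm right_diff_distrib)
      then show ?thesis using assms by (simp add: norm_mult)
    qed
    then have "Re (1 - w / z) < 1" using complex_Re_le_cmod order_le_less_trans by blast
    then have "Re (w / z) > 0" by simp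
    then show ?thesis by (auto simp: complex_nonpos_Reals_iff)
  qed
  have "?l holomorphic_on ?U"
    using notin assms by (intro holomorphic_intros) auto
  moreover have "exp (?l w) = w" if "w \<in> ?U" for w
    using notin[OF that] assms by (simp add: exp_add)
  ultimately have "log_branch ?U ?l \<and> z \<in> ?U"
    using assms by (simp add: log_branch_def)
  then show ?thesis by blast
qed

lemma log_branch_deriv:
  assumes "log_branch U l" "z \<in> U"
  shows "(l has_field_derivative 1 / z) (at z)"
proof -
  have U: "open U" "l holomorphic_on U" "\<And>w. w \<in> U \<Longrightarrow> exp (l w) = w"
    using assms(1) by (auto simp: log_branch_def)
  have z: "z \<noteq> 0" using U(3)[OF assms(2)] by auto
  obtain D where D: "(l has_field_derivative D) (at z)"
    using holomorphic_on_imp_differentiable_at[OF U(2,1) assms(2)]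
    by (auto simp: field_differentiable_def)
  have "((\<lambda>w. exp (l w)) has_field_derivative exp (l z) * D) (at z)"
    by (rule DERIV_fun_exp[OF D])
  then have "((\<lambda>w. w) has_field_derivative exp (l z) * D) (at z)"
    by (rule has_field_derivative_transform_within_open[OF _ U(1) assms(2) U(3)])
  then have "z * D = 1" using DERIV_unique[OF _ DERIV_ident] U(3)[OF assms(2)] by metis
  then have "D = 1 / z" using z by (simp add: field_simps)
  then show ?thesis using D by simp
qed

lemma pcoord_eq_edge_diff: "pcoord x e = edge_diff (ycoord x) e"
  by (cases e) (simp add: pcoord_def edge_diff_def)

lemma ycoord_upd:
  assumes "m \<ge> 1" "v \<ge> 1"
  shows "ycoord (x(m := t)) v = (if v = m + 2 then t else ycoord x v)"
  using assms by (auto simp: ycoord_def)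

lemma DERIV_pcoord:
  assumes "two_tree k T" "e \<in> T" "m \<ge> 1"
  shows "((\<lambda>t. pcoord (x(m := t)) e) has_field_derivative
    of_bool (snd e = m + 2) - of_bool (fst e = m + 2)) (at t0)"
proof -
  have "fst e \<ge> 1" "snd e \<ge> 1" using two_tree_edge[OF assms(1), of "fst e" "snd e"] assms(2) by auto
  then have "(\<lambda>t. pcoord (x(m := t)) e) =
    (\<lambda>t. (if snd e = m + 2 then t else ycoord x (snd e)) - (if fst e = m + 2 then t else ycoord x (fst e)))"
    using assms(3) by (simp only: pcoord_eq_edge_diff edge_diff_def ycoord_upd)
  then show ?thesis by (auto intro!: derivative_eq_intros)
qed

lemma DERIV_potential:
  assumes "two_tree k T" "m \<ge> 1" "\<And>e. e \<in> T \<Longrightarrow> log_branch (U e) (l e) \<and> pcoord x e \<in> U e"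
  shows "((\<lambda>t. potential T s l (x(m := t))) has_field_derivative
    vertex_force T s (ycoord x) (m + 2)) (at (x m))"
proof -
  have "((\<lambda>t. s e * l e (pcoord (x(m := t)) e)) has_field_derivative
    (of_bool (snd e = m + 2) - of_bool (fst e = m + 2)) / edge_diff (ycoord x) e * s e) (at (x m))"
    if e: "e \<in> T" for e
  proof -
    have "(l e has_field_derivative 1 / pcoord x e) (at (pcoord (x(m := x m)) e))"
      using assms(3)[OF e] by (simp add: log_branch_deriv[of "U e"])
    from DERIV_chain2[OF this DERIV_pcoord[OF assms(1) e assms(2)]]
    have "((\<lambda>t. l e (pcoord (x(m := t)) e)) has_field_derivative
      1 / pcoord x e * (of_bool (snd e = m + 2) - of_bool (fst e = m + 2))) (at (x m))" .
    from DERIV_cmult[OF this, of "s e"] show ?thesis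
      by (simp add: pcoord_eq_edge_diff mult_ac)
  qed
  then show ?thesis unfolding potential_def vertex_force_def by (rule DERIV_sum)
qed

lemma is_critical_iff:
  assumes "two_tree (n - 1) T" "n \<ge> 4" "x \<in> config_space n T"
  shows "is_critical n T s x \<longleftrightarrow> (\<forall>v\<in>{3..n - 1}. vertex_force T s (ycoord x) v = 0)"
proof
  assume "is_critical n T s x"
  then obtain U l where Ul: "\<forall>e\<in>T. log_branch (U e) (l e) \<and> pcoord x e \<in> U e"
    and crit: "\<forall>m\<in>{1..n - 3}. ((\<lambda>t. potential T s l (x(m := t))) has_field_derivative 0) (at (x m))"
    unfolding is_critical_def by blast
  show "\<forall>v\<in>{3..n - 1}. vertex_force T s (ycoord x) v = 0"
  proof
    fix v assume v: "v \<in> {3..n - 1}"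
    define m where "m = v - 2"
    have m: "m \<in> {1..n - 3}" "m \<ge> 1" "v = m + 2" using v by (auto simp: m_def)
    show "vertex_force T s (ycoord x) v = 0"
      unfolding m(3) using DERIV_unique[OF DERIV_potential[OF assms(1) m(2)] bspec[OF crit m(1)]] Ul
      by blast
  qed
next
  assume forces: "\<forall>v\<in>{3..n - 1}. vertex_force T s (ycoord x) v = 0"
  have "\<forall>e\<in>T. \<exists>U l. log_branch U l \<and> pcoord x e \<in> U"
    using assms(3) log_branch_exists by (simp add: config_space_def)
  then obtain U l where Ul: "\<And>e. e \<in> T \<Longrightarrow> log_branch (U e) (l e) \<and> pcoord x e \<in> U e"
    by metis
  have "((\<lambda>t. potential T s l (x(m := t))) has_field_derivative 0) (at (x m))" if "m \<in> {1..n - 3}" for m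
  proof -
    have m: "m \<ge> 1" "m + 2 \<in> {3..n - 1}" using that assms(2) by auto
    have "((\<lambda>t. potential T s l (x(m := t))) has_field_derivative
      vertex_force T s (ycoord x) (m + 2)) (at (x m))"
      by (rule DERIV_potential[OF assms(1) m(1) Ul])
    then show ?thesis using forces m(2) by simp
  qed
  then show "is_critical n T s x" unfolding is_critical_def using Ul by blast
qed

section \<open>Configurations with prescribed edge differences\<close>

lemma ycoord_surj:
  assumes "n \<ge> 4" "y 1 = 0" "y 2 = 1"
  obtains x where "x \<in> cspace {1..n - 3}" "\<And>v. v \<in> {1..n - 1} \<Longrightarrow> ycoord x v = y v"
proof
  let ?x = "\<lambda>m. if m \<in> {1..n - 3} then y (m + 2) else 0"
  show "?x \<in> cspace {1..n - 3}" by (simp add: cspace_def)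
  show "ycoord ?x v = y v" if "v \<in> {1..n - 1}" for v
  proof -
    have "v = 1 \<or> v = 2 \<or> v \<ge> 3" using that by auto
    moreover have "v \<ge> 3 \<Longrightarrow> v - 2 \<in> {1..n - 3} \<and> v - 2 + 2 = v" using that by auto
    ultimately show ?thesis using assms by (auto simp: ycoord_def)
  qed
qed

lemma config_point_exists:
  assumes "n \<ge> 4" "two_tree (n - 1) T" "y 1 = 0" "y 2 = 1" "\<And>e. e \<in> T \<Longrightarrow> edge_diff y e \<noteq> 0"
  obtains x where "x \<in> config_space n T" "\<And>e. e \<in> T \<Longrightarrow> pcoord x e = edge_diff y e"
proof -
  obtain x where x: "x \<in> cspace {1..n - 3}" "\<And>v. v \<in> {1..n - 1} \<Longrightarrow> ycoord x v = y v"
    using ycoord_surj assms(1,3,4) by metis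
  have diff: "pcoord x e = edge_diff y e" if "e \<in> T" for e
  proof -
    have "fst e \<in> {1..n - 1}" "snd e \<in> {1..n - 1}"
      using two_tree_edge[OF assms(2), of "fst e" "snd e"] that by auto
    then show ?thesis by (simp add: pcoord_eq_edge_diff edge_diff_def x(2))
  qed
  then have "x \<in> config_space n T" using x(1) assms(5) by (simp add: config_space_def)
  then show ?thesis using diff that by blast
qed

section \<open>The matrix of a 2-tree is a Horn matrix\<close>

lemma triple_block_eq:
  fixes d :: nat
  assumes "m < d"
  shows "{r \<in> {1..3 * d}. (r - 1) div 3 = m} = {3 * m + 1, 3 * m + 2, 3 * m + 3}"
proof (intro set_eqI iffI)
  fix r assume "r \<in> {r \<in> {1..3 * d}. (r - 1) div 3 = m}"
  then have "1 \<le> r" "(r - 1) div 3 = m" by auto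
  then have "r = 3 * m + 1 \<or> r = 3 * m + 2 \<or> r = 3 * m + 3" by presburger
  then show "r \<in> {3 * m + 1, 3 * m + 2, 3 * m + 3}" by blast
next
  fix r assume "r \<in> {3 * m + 1, 3 * m + 2, 3 * m + 3}"
  then have "r = 3 * m + 1 \<or> r = 3 * m + 2 \<or> r = 3 * m + 3" by blast
  then have "r \<in> {1..3 * d} \<and> (r - 1) div 3 = m" using assms by auto
  then show "r \<in> {r \<in> {1..3 * d}. (r - 1) div 3 = m}" by blast
qed

lemma row_partition_triples:
  assumes "d > 0"
  shows "row_partition {1..3 * d} d (\<lambda>r. (r - 1) div 3)"
proof
  show "(\<lambda>r. (r - 1) div 3) ` {1..3 * d} = {..<d}"
  proof (intro set_eqI iffI)
    fix m assume "m \<in> {..<d}"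
    then have "3 * m + 1 \<in> {r \<in> {1..3 * d}. (r - 1) div 3 = m}" using triple_block_eq[of m d] by blast
    then have "3 * m + 1 \<in> {1..3 * d}" "m = (3 * m + 1 - 1) div 3" by auto
    then show "m \<in> (\<lambda>r. (r - 1) div 3) ` {1..3 * d}" by blast
  next
    fix m assume "m \<in> (\<lambda>r. (r - 1) div 3) ` {1..3 * d}"
    then obtain r where "1 \<le> r" "r \<le> 3 * d" "m = (r - 1) div 3" by auto
    then show "m \<in> {..<d}" unfolding lessThan_iff by presburger
  qed
qed (use assms in auto)

lemma constant_on_triples_iff:
  fixes a :: "nat \<Rightarrow> int"
  shows "(\<forall>m<d. a (3 * m + 1) = a (3 * m + 3) \<and> a (3 * m + 2) = a (3 * m + 3)) \<longleftrightarrow>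
    (\<forall>r\<in>{1..3 * d}. \<forall>r'\<in>{1..3 * d}. (r - 1) div 3 = (r' - 1) div 3 \<longrightarrow> a r = a r')"
    (is "?L \<longleftrightarrow> ?R")
proof
  assume L: ?L
  have "a r = a (3 * ((r - 1) div 3) + 3)" if "r \<in> {1..3 * d}" for r
  proof -
    have "(r - 1) div 3 < d" using that by auto
    moreover have "r \<in> {r' \<in> {1..3 * d}. (r' - 1) div 3 = (r - 1) div 3}" using that by blast
    ultimately have "r \<in> {3 * ((r - 1) div 3) + 1, 3 * ((r - 1) div 3) + 2, 3 * ((r - 1) div 3) + 3}"
      by (simp only: triple_block_eq)
    then show ?thesis using L \<open>(r - 1) div 3 < d\<close> by (metis (no_types, lifting) insertE singletonD)
  qed
  then show ?R by metis
next
  assume R: ?R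
  show ?L
  proof (intro allI impI)
    fix m assume "m < d"
    then have "{3 * m + 1, 3 * m + 2, 3 * m + 3} \<subseteq> {r \<in> {1..3 * d}. (r - 1) div 3 = m}"
      by (simp only: triple_block_eq subset_refl)
    then have "3 * m + 1 \<in> {1..3 * d}" "(3 * m + 1 - 1) div 3 = m"
      "3 * m + 2 \<in> {1..3 * d}" "(3 * m + 2 - 1) div 3 = m"
      "3 * m + 3 \<in> {1..3 * d}" "(3 * m + 3 - 1) div 3 = m" by blast+
    then show "a (3 * m + 1) = a (3 * m + 3) \<and> a (3 * m + 2) = a (3 * m + 3)"
      using R by metis
  qed
qed

lemma left_kernel_tree_matrix:
  assumes "two_tree k T"
  shows "left_kernel {1..3 * (k - 2)} T (tree_matrix k T) =
    {a. (\<forall>r. r \<notin> {1..3 * (k - 2)} \<longrightarrow> a r = 0) \<and> (\<forall>r\<in>{1..3 * (k - 2)}.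
      \<forall>r'\<in>{1..3 * (k - 2)}. (r - 1) div 3 = (r' - 1) div 3 \<longrightarrow> a r = a r')}"
proof -
  have rows: "3 * (k - 2) = 3 * k - 6" by simp
  show ?thesis
    unfolding left_kernel_def constant_on_triples_iff[symmetric]
      tree_matrix_orthogonal_iff[OF assms, folded rows] ..
qed

lemma tree_matrix_column_sum:
  assumes "two_tree k T" "e \<in> T"
  shows "(\<Sum>r\<in>{1..3 * (k - 2)}. tree_matrix k T r e) = 0"
proof -
  have rows: "3 * (k - 2) = 3 * k - 6" by simp
  have "\<forall>e\<in>T. (\<Sum>r\<in>{1..3 * k - 6}. 1 * tree_matrix k T r e) = 0"
    using tree_matrix_orthogonal_iff[OF assms(1), of "\<lambda>_. 1"] by blast
  then show ?thesis unfolding rows using assms(2) by simp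
qed

lemma discriminantal_variety_triples:
  assumes "k \<ge> 3"
  shows "discriminantal_variety {1..3 * (k - 2)} (k - 2)
      (row_partition.block_matrix {1..3 * (k - 2)} (\<lambda>r. (r - 1) div 3)) =
    {q \<in> cspace {1..3 * (k - 2)}. triple_sums_zero k q}"
proof -
  have d: "k - 2 > 0" using assms by simp
  have "(\<Sum>r\<in>{r \<in> {1..3 * (k - 2)}. (r - 1) div 3 = m}. q r) =
      q (3 * m + 1) + q (3 * m + 2) + q (3 * m + 3)" if "m < k - 2" for m and q :: "nat \<Rightarrow> complex"
    unfolding triple_block_eq[OF that] by (simp add: add.assoc)
  then show ?thesis
    unfolding row_partition.discriminantal_variety_block_matrix[OF row_partition_triples[OF d]]
      triple_sums_zero_def by auto
qed

lemma monomial_map_eq_tree_monomial: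
  assumes "two_tree k T" "e \<in> T" "lam e = \<sigma> e"
  shows "monomial_map {1..3 * (k - 2)} T lam (tree_matrix k T) q e = tree_monomial k T \<sigma> q e"
proof -
  have rows: "3 * (k - 2) = 3 * k - 6" by simp
  show ?thesis
    unfolding monomial_map_def tree_monomial_def rows
    using assms by (simp add: tree_matrix_eq_edge_column[OF assms(1)])
qed

lemma monomial_map_outside: "e \<notin> E \<Longrightarrow> monomial_map R E lam H q e = 0"
  by (simp add: monomial_map_def)

text \<open>
  By the triangle relations, the monomial map sends the torus points with zero triple sums onto the whole
  variety and not merely onto a dense subset.
\<close>

lemma is_horn_matrix_tree_matrix:
  assumes "n \<ge> 4" "signed_tree (n - 1) T \<sigma>"
  shows "is_horn_matrix {1..3 * (n - 3)} T (tree_matrix (n - 1) T) (tree_variety n T)"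
proof -
  let ?k = "n - 1" and ?d = "n - 3" and ?R = "{1..3 * (n - 3)}" and ?\<beta> = "\<lambda>r :: nat. (r - 1) div 3"
  have t: "two_tree (n - 1) T" by (rule signed_tree_imp_two_tree[OF assms(2)])
  have k: "n - 1 - 2 = n - 3" "n - 1 \<ge> 3" "n - 3 > 0" using assms(1) by auto
  have rows: "{1..3 * (n - 1) - 6} = ?R" using assms(1) by (intro arg_cong2[of _ _ _ _ atLeastAtMost]) auto
  interpret row_partition ?R ?d ?\<beta> by (rule row_partition_triples[OF k(3)])
  define lam where "lam = (\<lambda>e. if e \<in> T then \<sigma> e else 0)"
  let ?m = "monomial_map ?R T lam (tree_matrix ?k T)"
  have m: "?m q e = tree_monomial ?k T \<sigma> q e" if "e \<in> T" for q e
    by (rule monomial_map_eq_tree_monomial[where k = "n - 1" and lam = lam and \<sigma> = \<sigma>,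
        unfolded k, OF t that])
      (simp add: lam_def that)
  have "\<sigma> e \<noteq> 0" for e using signed_tree_signs(2)[OF assms(2), of e] by auto
  then have lam: "lam \<in> ctorus T" by (simp add: lam_def ctorus_def cspace_def)
  have "lattice_basis ?d block_matrix (left_kernel ?R T (tree_matrix ?k T))"
    using lattice_basis_block_matrix unfolding left_kernel_tree_matrix[OF t, unfolded k] .
  moreover have "?m ` (discriminantal_variety ?R ?d block_matrix \<inter> ctorus ?R) = tree_variety n T"
  proof -
    have disc: "discriminantal_variety ?R ?d block_matrix = {q \<in> cspace ?R. triple_sums_zero ?k q}"
      by (rule discriminantal_variety_triples[OF k(2), unfolded k])
    show ?thesis
      unfolding disc
    proof (intro equalityI subsetI)
      fix p assume "p \<in> ?m ` ({q \<in> cspace ?R. triple_sums_zero ?k q} \<inter> ctorus ?R)"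
      then obtain q where q: "p = ?m q" "triple_sums_zero ?k q" "q \<in> ctorus ?R" by auto
      have nz: "q r \<noteq> 0" if "r \<in> {1..3 * ?k - 6}" for r
        using q(3) that unfolding rows ctorus_def by blast
      obtain y where y: "y 1 = 0" "y 2 = 1"
          "\<forall>e\<in>insert (1, 2) T. edge_diff y e = tree_monomial ?k T \<sigma> q e"
        using tree_monomial_imp_edge_diff[OF assms(2) nz q(2)] by blast
      have "edge_diff y e \<noteq> 0" if "e \<in> T" for e
        using y(3) that tree_monomial_nonzero[OF assms(2) nz] by auto
      then obtain x where x: "x \<in> config_space n T" "\<And>e. e \<in> T \<Longrightarrow> pcoord x e = edge_diff y e"
        using config_point_exists[OF assms(1) t y(1,2)] by blast
      have "p e = pvec T x e" for e
        using x(2) y(3) by (cases "e \<in> T") (simp_all add: q(1) m monomial_map_outside pvec_def)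
      then have "p = pvec T x" by (rule ext)
      then show "p \<in> tree_variety n T" unfolding tree_variety_def using x(1) by blast
    next
      fix p assume "p \<in> tree_variety n T"
      then obtain x where x: "x \<in> config_space n T" "p = pvec T x" unfolding tree_variety_def by blast
      have "edge_diff (ycoord x) e \<noteq> 0" if "e \<in> T" for e
        using x(1) that by (simp add: config_space_def pcoord_eq_edge_diff)
      moreover have "ycoord x 1 = 0" "ycoord x 2 = 1" by (simp_all add: ycoord_def)
      ultimately obtain q where q: "\<forall>r\<in>{1..3 * ?k - 6}. q r \<noteq> 0" "triple_sums_zero ?k q"
          "\<forall>e\<in>insert (1, 2) T. edge_diff (ycoord x) e = tree_monomial ?k T \<sigma> q e"
        using edge_diff_imp_tree_monomial[OF assms(2), of "ycoord x"] by blast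
      define q' where "q' r = (if r \<in> ?R then q r else 0)" for r
      have q'q: "q' r = q r" if "r \<in> {1..3 * ?k - 6}" for r using that unfolding rows q'_def by simp
      have "q' \<in> ctorus ?R" using q(1) unfolding rows by (simp add: q'_def ctorus_def cspace_def)
      moreover have "triple_sums_zero ?k q'" using q(2) triple_sums_zero_cong[of ?k q' q] q'q by blast
      moreover have "p = ?m q'"
      proof
        fix e
        have "tree_monomial ?k T \<sigma> q' e = tree_monomial ?k T \<sigma> q e"
          by (rule tree_monomial_cong) (rule q'q)
        then show "p e = ?m q' e"
          using q(3) x(2)
          by (cases "e \<in> T") (simp_all add: m monomial_map_outside pvec_def pcoord_eq_edge_diff)
      qed
      ultimately show "p \<in> ?m ` ({q \<in> cspace ?R. triple_sums_zero ?k q} \<inter> ctorus ?R)"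
        unfolding ctorus_def by blast
    qed
  qed
  moreover have "tree_variety n T \<subseteq> zariski_closure T (tree_variety n T)"
    by (auto simp: zariski_closure_def tree_variety_def pvec_def cspace_def)
  ultimately have "\<exists>d A. lattice_basis d A (left_kernel ?R T (tree_matrix ?k T)) \<and>
      (let Y = ?m ` (discriminantal_variety ?R d A \<inter> ctorus ?R)
       in Y \<subseteq> tree_variety n T \<and> tree_variety n T \<subseteq> zariski_closure T Y)"
    by (intro exI[of _ ?d] exI[of _ block_matrix]) simp
  then show ?thesis
    unfolding is_horn_matrix_def using lam tree_matrix_column_sum[OF t, unfolded k] by blast
qed

section \<open>The critical point\<close>

text \<open>
  Existence holds because $H_T s$ has zero triple sums, so that its monomials are the edge differences of
  some configuration.
\<close>

lemma critical_points_eq: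
  fixes s :: "edge \<Rightarrow> complex"
  assumes "n \<ge> 4" "signed_tree (n - 1) T \<sigma>" "\<And>e. e \<in> T \<Longrightarrow> lam e = \<sigma> e"
  defines "q \<equiv> mat_vec {1..3 * (n - 3)} T (tree_matrix (n - 1) T) s"
  assumes nz: "\<And>r. r \<in> {1..3 * (n - 3)} \<Longrightarrow> q r \<noteq> 0"
  shows "critical_points n T s =
    {monomial_map {1..3 * (n - 3)} T lam (tree_matrix (n - 1) T) q}"
proof -
  let ?k = "n - 1" and ?R = "{1..3 * (n - 3)}"
  let ?p = "monomial_map ?R T lam (tree_matrix ?k T) q" and ?I = "tree_image (n - 1) T s"
  have t: "two_tree (n - 1) T" by (rule signed_tree_imp_two_tree[OF assms(2)])
  have k: "n - 1 - 2 = n - 3" using assms(1) by auto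
  have rows: "{1..3 * (n - 1) - 6} = ?R" using assms(1) by (intro arg_cong2[of _ _ _ _ atLeastAtMost]) auto
  have qI: "q r = ?I r" if "r \<in> ?R" for r
    using that unfolding q_def mat_vec_def tree_image_def
    by (simp add: tree_matrix_eq_edge_column[OF t])
  have nzI: "?I r \<noteq> 0" if "r \<in> {1..3 * ?k - 6}" for r using nz that qI unfolding rows by auto
  have p: "?p e = tree_monomial ?k T \<sigma> ?I e" if "e \<in> T" for e
  proof -
    have "?p e = tree_monomial ?k T \<sigma> q e"
      by (rule monomial_map_eq_tree_monomial[where k = "n - 1" and lam = lam and \<sigma> = \<sigma>,
        unfolded k, OF t that assms(3)[OF that]])
    also have "\<dots> = tree_monomial ?k T \<sigma> ?I e"
      by (rule tree_monomial_cong) (simp only: rows qI)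
    finally show ?thesis .
  qed
  have crit: "is_critical n T s x \<longleftrightarrow> pvec T x = ?p" if x: "x \<in> config_space n T" for x
  proof -
    have "edge_diff (ycoord x) e \<noteq> 0" if "e \<in> T" for e
      using x that by (simp add: config_space_def pcoord_eq_edge_diff)
    moreover have y: "ycoord x 1 = 0" "ycoord x 2 = 1" by (simp_all add: ycoord_def)
    ultimately have "is_critical n T s x \<longleftrightarrow>
      (\<forall>e\<in>insert (1, 2) T. edge_diff (ycoord x) e = tree_monomial ?k T \<sigma> ?I e)"
      unfolding is_critical_iff[OF t assms(1) x]
      using vertex_force_iff_tree_monomial[OF assms(2), of "ycoord x" s] nzI by blast
    also have "\<dots> \<longleftrightarrow> (\<forall>e\<in>T. pcoord x e = ?p e)"
      using y tree_monomial_root[OF assms(2)] by (auto simp: pcoord_eq_edge_diff p edge_diff_def)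
    also have "\<dots> \<longleftrightarrow> pvec T x = ?p"
      by (auto simp: fun_eq_iff pvec_def monomial_map_outside)
    finally show ?thesis .
  qed
  obtain y where y: "y 1 = 0" "y 2 = 1"
      "\<forall>e\<in>insert (1, 2) T. edge_diff y e = tree_monomial ?k T \<sigma> ?I e"
    using tree_monomial_imp_edge_diff[OF assms(2) nzI triple_sums_zero_tree_image[OF t]] by blast
  have "edge_diff y e \<noteq> 0" if "e \<in> T" for e
    using y(3) that tree_monomial_nonzero[OF assms(2) nzI] by auto
  then obtain x where x: "x \<in> config_space n T" "\<And>e. e \<in> T \<Longrightarrow> pcoord x e = edge_diff y e"
    using config_point_exists[OF assms(1) t y(1,2)] by blast
  have "pvec T x = ?p"
    using x(2) y(3) by (auto simp: fun_eq_iff pvec_def p monomial_map_outside)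
  then have "x \<in> {x \<in> config_space n T. pvec T x = ?p}" using x(1) by simp
  moreover have "{x \<in> config_space n T. is_critical n T s x} = {x \<in> config_space n T. pvec T x = ?p}"
    using crit by (intro Collect_cong conj_cong refl)
  ultimately show ?thesis unfolding critical_points_def by auto
qed

lemma for_general_mat_vec_nonzero:
  assumes "n \<ge> 4" "two_tree (n - 1) T"
  shows "for_general T (\<lambda>s. \<forall>r\<in>{1..3 * (n - 3)}.
    mat_vec {1..3 * (n - 3)} T (tree_matrix (n - 1) T) s r \<noteq> 0)"
proof -
  let ?R = "{1..3 * (n - 3)}" and ?H = "tree_matrix (n - 1) T"
  let ?f = "\<lambda>s. \<Prod>r\<in>?R. \<Sum>e\<in>T. of_int (?H r e) * s e"
  let ?Z = "{s \<in> cspace T. ?f s = 0}"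
  have fin: "finite T" using card_two_tree[OF assms(2)] by simp
  have rows: "{1..3 * (n - 1) - 6} = ?R" using assms(1) by (intro arg_cong2[of _ _ _ _ atLeastAtMost]) auto
  have "?f \<in> poly_funs T"
    using fin by (intro poly_funs_prod poly_funs_sum poly_funs.intros) auto
  then have closed: "zariski_closed T ?Z"
    unfolding zariski_closed_def by (intro exI[of _ "{?f}"]) auto
  \<comment> \<open>Equal weights show that the exceptional set is a proper subset.\<close>
  define s where "s e = (if e \<in> T then 1 else 0 :: complex)" for e
  have "(\<Sum>e\<in>T. of_int (?H r e) * s e) \<noteq> 0" if "r \<in> ?R" for r
  proof -
    have "tree_image (n - 1) T s r \<noteq> 0"
      by (rule tree_image_Re_pos_nonzero[OF assms(2)]) (use that rows in \<open>simp_all add: s_def\<close>)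
    then show ?thesis unfolding tree_image_def by (simp add: tree_matrix_eq_edge_column[OF assms(2)])
  qed
  then have "s \<notin> ?Z" by simp
  moreover have "s \<in> cspace T" by (simp add: s_def cspace_def)
  ultimately have "?Z \<noteq> cspace T" by blast
  moreover have "\<forall>r\<in>?R. mat_vec ?R T ?H s r \<noteq> 0" if "s \<in> cspace T - ?Z" for s
    using that by (auto simp: mat_vec_def)
  ultimately show ?thesis unfolding for_general_def using closed by blast
qed

theorem theorem3p1:
  fixes n :: nat and T :: "edge set"
  assumes "n \<ge> 4"
    and "two_tree (n - 1) T"
  shows "is_horn_matrix {1..3 * n - 9} T (tree_matrix (n - 1) T) (tree_variety n T) \<and>
    (\<exists>lam \<in> cspace T. (\<forall>e\<in>T. lam e \<in> {-1, 1}) \<and>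
       for_general T (\<lambda>s.
         critical_points n T s =
           {monomial_map {1..3 * n - 9} T lam (tree_matrix (n - 1) T)
              (mat_vec {1..3 * n - 9} T (tree_matrix (n - 1) T) s)}))"
proof -
  have rows: "3 * n - 9 = 3 * (n - 3)" by simp
  obtain \<sigma> where \<sigma>: "signed_tree (n - 1) T \<sigma>" using two_tree_imp_signed_tree[OF assms(2)] by blast
  define lam where "lam e = (if e \<in> T then \<sigma> e else 0)" for e
  have "lam \<in> cspace T" by (simp add: lam_def cspace_def)
  moreover have "\<forall>e\<in>T. lam e \<in> {-1, 1}" using signed_tree_signs(2)[OF \<sigma>] by (auto simp: lam_def)
  moreover have "for_general T (\<lambda>s. critical_points n T s =
      {monomial_map {1..3 * (n - 3)} T lam (tree_matrix (n - 1) T)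
        (mat_vec {1..3 * (n - 3)} T (tree_matrix (n - 1) T) s)})"
    using for_general_mat_vec_nonzero[OF assms] critical_points_eq[OF assms(1) \<sigma>, of lam]
    unfolding for_general_def by (auto simp: lam_def)
  ultimately show ?thesis
    unfolding rows using is_horn_matrix_tree_matrix[OF assms(1) \<sigma>] by blast
qed

end
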